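(* There is a metric space $(M,d)$ with the following properties: (a) The metric $d$ is the shortest-path distance on a countable graph. (b) The metric $d$ attains only values $0,1,2,3$. (c) $\mathcal F(M)$ has the $3$-Schur property but fails the $c$-Schur property for $c<3$. (d) For each $c<2$, $\mathcal F(M)$ fails the property that $\widetilde{\operatorname{ca}}(x_n)\le c\,\delta(x_n)$ for each bounded sequence $(x_n)$ in $\mathcal F(M)$. In particular, $\mathcal F(M)$ fails the $1$-strong Schur property.
   Context: All spaces are real. For a metric space $(M,d)$ with a distinguished point $0\in M$, $\operatorname{Lip}_0(M)$ is the Banach space of real-valued Lipschitz functions on $M$ vanishing at $0$, normed by the least Lipschitz constant; for $x\in M$, $\delta(x)\in\operatorname{Lip}_0(M)^*$ is the evaluation $f\mapsto f(x)$; the Lipschitz-free space is $\mathcal F(M)=\overline{\operatorname{span}}\{\delta(x): x\in M\}\subset\operatorname{Lip}_0(M)^*$ (up to isometry independent of the choice of the distinguished point). For a bounded sequence in a Banach space $X$ put $\operatorname{ca}(x_n)=\inf_{n}\operatorname{diam}\{x_k: k\ge n\}$ (also for scalar sequences), $\widetilde{\operatorname{ca}}(x_n)=\inf\{\operatorname{ca}(x_{n_k}): (n_k)\text{ strictly increasing}\}$ and $\delta(x_n)=\sup\{\operatorname{ca}(x^*(x_n)): x^*\in B_{X^*}\}$. $X$ has the $c$-Schur property if $\operatorname{ca}(x_n)\le c\,\delta(x_n)$ for each bounded sequence $(x_n)$ in $X$. $X$ has the $1$-strong Schur property if for any $\delta\in(0,2]$, any $\varepsilon>0$ and any normalized $\delta$-separated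 sequence in $X$ (i.e. $\|x_n\|=1$ and $\|x_n-x_m\|\ge\delta$ for $n\neq m$) there is a subsequence which is $(\frac2\delta+\varepsilon)$-equivalent to the standard basis of $\ell_1$; a normalized sequence $(y_j)$ is $K$-equivalent to the standard basis of $\ell_1$ if $\frac1K\sum_{j=1}^m|\alpha_j|\le\|\sum_{j=1}^m\alpha_jy_j\|$ for all $m$ and real $\alpha_1,\dots,\alpha_m$. *)

theory Defs
  imports "HOL-Analysis.Analysis" "HOL-Library.Function_Algebras"
begin

section \<open>Functions as a real vector space\<close>

instantiation "fun" :: (type, real_vector) real_vector
begin

definition scaleR_fun :: "real \<Rightarrow> ('a \<Rightarrow> 'b) \<Rightarrow> 'a \<Rightarrow> 'b"
  where "scaleR_fun r f = (\<lambda>x. r *\<^sub>R f x)"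

instance
  by standard (auto simp: scaleR_fun_def fun_eq_iff scaleR_add_right scaleR_add_left)

end

section \<open>Normed spaces given by a carrier and a norm function\<close>

text \<open>
  The Lipschitz-free space depends on a metric space that is existentially quantified in the
  theorem, so it cannot be a type. A normed space is therefore given by a linear subspace
  \<open>V\<close> of an ambient real vector space and a function \<open>N\<close> that is a norm on \<open>V\<close>; the values
  of \<open>N\<close> outside \<open>V\<close> are irrelevant. Functionals on \<open>V\<close> are represented by functions
  vanishing outside \<open>V\<close>, so that equality in the dual is equality of functions.
\<close>

definition dual_space :: "'a::real_vector set \<Rightarrow> ('a \<Rightarrow> real) \<Rightarrow> ('a \<Rightarrow> real) set" where
  "dual_space V N = {\<phi>.
     (\<forall>x\<in>V. \<forall>y\<in>V. \<phi> (x + y) = \<phi> x + \<phi> y) \<and>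
     (\<forall>a. \<forall>x\<in>V. \<phi> (a *\<^sub>R x) = a * \<phi> x) \<and>
     (\<exists>B. \<forall>x\<in>V. \<bar>\<phi> x\<bar> \<le> B * N x) \<and>
     (\<forall>x. x \<notin> V \<longrightarrow> \<phi> x = 0)}"

definition dual_norm :: "'a::real_vector set \<Rightarrow> ('a \<Rightarrow> real) \<Rightarrow> ('a \<Rightarrow> real) \<Rightarrow> real" where
  "dual_norm V N \<phi> = (SUP x\<in>{x\<in>V. N x \<le> 1}. \<bar>\<phi> x\<bar>)"

definition dual_ball :: "'a::real_vector set \<Rightarrow> ('a \<Rightarrow> real) \<Rightarrow> ('a \<Rightarrow> real) set" where
  "dual_ball V N = {\<phi>\<in>dual_space V N. dual_norm V N \<phi> \<le> 1}"

definition bounded_seq :: "'a::real_vector set \<Rightarrow> ('a \<Rightarrow> real) \<Rightarrow> (nat \<Rightarrow> 'a) \<Rightarrow> bool" where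
  "bounded_seq V N x \<longleftrightarrow> (\<forall>n. x n \<in> V) \<and> (\<exists>B. \<forall>n. N (x n) \<le> B)"

section \<open>Quantitative Schur properties\<close>

text \<open>
  The suprema and infima below are taken in the reals; they are meaningful for bounded
  sequences, the only ones to which these quantities are applied.
\<close>

definition diam :: "('a::real_vector \<Rightarrow> real) \<Rightarrow> 'a set \<Rightarrow> real" where
  "diam N S = (SUP (x, y)\<in>S \<times> S. N (x - y))"

definition ca :: "('a::real_vector \<Rightarrow> real) \<Rightarrow> (nat \<Rightarrow> 'a) \<Rightarrow> real" where
  "ca N x = (INF n. diam N (x ` {n..}))"

definition ca_tilde :: "('a::real_vector \<Rightarrow> real) \<Rightarrow> (nat \<Rightarrow> 'a) \<Rightarrow> real" where
  "ca_tilde N x = (INF r\<in>{r::nat \<Rightarrow> nat. strict_mono r}. ca N (x \<circ> r))"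

definition delta :: "'a::real_vector set \<Rightarrow> ('a \<Rightarrow> real) \<Rightarrow> (nat \<Rightarrow> 'a) \<Rightarrow> real" where
  "delta V N x = (SUP \<phi>\<in>dual_ball V N. ca abs (\<phi> \<circ> x))"

definition Schur_property :: "real \<Rightarrow> 'a::real_vector set \<Rightarrow> ('a \<Rightarrow> real) \<Rightarrow> bool" where
  "Schur_property c V N \<longleftrightarrow> (\<forall>x. bounded_seq V N x \<longrightarrow> ca N x \<le> c * delta V N x)"

definition equiv_l1_basis :: "real \<Rightarrow> ('a::real_vector \<Rightarrow> real) \<Rightarrow> (nat \<Rightarrow> 'a) \<Rightarrow> bool" where
  "equiv_l1_basis K N y \<longleftrightarrow>
     (\<forall>m. \<forall>\<alpha>::nat \<Rightarrow> real. (1 / K) * (\<Sum>j<m. \<bar>\<alpha> j\<bar>) \<le> N (\<Sum>j<m. \<alpha> j *\<^sub>R y j))"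

definition one_strong_Schur :: "'a::real_vector set \<Rightarrow> ('a \<Rightarrow> real) \<Rightarrow> bool" where
  "one_strong_Schur V N \<longleftrightarrow>
     (\<forall>d \<epsilon> x. 0 < d \<and> d \<le> 2 \<and> 0 < \<epsilon> \<and> (\<forall>n. x n \<in> V \<and> N (x n) = 1) \<and>
        (\<forall>n m. n \<noteq> m \<longrightarrow> d \<le> N (x n - x m)) \<longrightarrow>
        (\<exists>r::nat \<Rightarrow> nat. strict_mono r \<and> equiv_l1_basis (2 / d + \<epsilon>) N (x \<circ> r)))"

section \<open>Lipschitz-free spaces\<close>

text \<open>
  Functions on \<open>mspace m\<close> are extended by zero to the whole type; \<open>z\<close> is the
  distinguished point.
\<close>

definition Lip0 :: "'a metric \<Rightarrow> 'a \<Rightarrow> ('a \<Rightarrow> real) set" where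
  "Lip0 m z = {f. Lipschitz_continuous_map m euclidean_metric f \<and> f z = 0 \<and>
     (\<forall>x. x \<notin> mspace m \<longrightarrow> f x = 0)}"

definition Lip_norm :: "'a metric \<Rightarrow> ('a \<Rightarrow> real) \<Rightarrow> real" where
  "Lip_norm m f =
     Inf {L. 0 \<le> L \<and> (\<forall>x\<in>mspace m. \<forall>y\<in>mspace m. \<bar>f x - f y\<bar> \<le> L * mdist m x y)}"

definition evaluation :: "'a metric \<Rightarrow> 'a \<Rightarrow> 'a \<Rightarrow> ('a \<Rightarrow> real) \<Rightarrow> real" where
  "evaluation m z x = (\<lambda>f. if f \<in> Lip0 m z then f x else 0)"

definition free_norm :: "'a metric \<Rightarrow> 'a \<Rightarrow> (('a \<Rightarrow> real) \<Rightarrow> real) \<Rightarrow> real" where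
  "free_norm m z = dual_norm (Lip0 m z) (Lip_norm m)"

definition free_space :: "'a metric \<Rightarrow> 'a \<Rightarrow> (('a \<Rightarrow> real) \<Rightarrow> real) set" where
  "free_space m z = {\<phi>\<in>dual_space (Lip0 m z) (Lip_norm m).
     \<forall>e>0. \<exists>\<psi>\<in>span (evaluation m z ` mspace m). free_norm m z (\<phi> - \<psi>) < e}"

section \<open>Shortest-path distances\<close>

text \<open>A simple undirected graph is given by its vertex set and its adjacency relation.\<close>

definition connected_graph :: "'a set \<Rightarrow> ('a \<times> 'a) set \<Rightarrow> bool" where
  "connected_graph V E \<longleftrightarrow> E \<subseteq> V \<times> V \<and> sym E \<and> irrefl E \<and> (\<forall>x\<in>V. \<forall>y\<in>V. (x, y) \<in> E\<^sup>*)"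

definition path_dist :: "('a \<times> 'a) set \<Rightarrow> 'a \<Rightarrow> 'a \<Rightarrow> nat" where
  "path_dist E x y = (LEAST n. (x, y) \<in> E ^^ n)"

end

theory Submission
  imports Defs "HOL-Complex_Analysis.Great_Picard"
begin

text \<open>
  The metric space is the vertex set of a graph with blocks of four vertices, the types \<open>0, 1, 2, 3\<close>.
  For positive \<open>n < k\<close>, type \<open>t\<close> of block \<open>n\<close> is adjacent to type \<open>t + 1\<close> (modulo \<open>4\<close>) of block \<open>k\<close>. Block
  \<open>0\<close> consists of four mutually adjacent hubs, each joined to all vertices of its type, which keeps
  all distances at most \<open>3\<close>. Two different vertices in the same positive block are neither
  adjacent nor have a common neighbour, so their distance is \<open>3\<close>.

  \<^item> Any metric on the natural numbers with distances between \<open>1\<close> and \<open>R\<close> has a free space with the \<open>R\<close>-Schur property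
  (\<open>Schur_property_diameter\<close>). A nonexpansive function has oscillation at most \<open>R\<close>, and every function
  of oscillation at most \<open>1\<close> is nonexpansive; for the norm dual to the oscillation, which makes the
  free space a rescaled copy of the sum-zero elements of \<open>\<ell>\<^sub>1\<close>, a gliding hump argument (\<open>gliding_hump\<close>) loses
  nothing.

  \<^item> Let \<open>x\<^sub>n\<close> and \<open>y\<^sub>n\<close> be the half sums of the evaluations at types \<open>0, 1\<close> and at types \<open>2, 3\<close> of block
  \<open>n\<close>. Then \<open>x\<^sub>n\<close> and \<open>y\<^sub>n\<close> have distance \<open>3\<close> (\<open>half_sums_same_block\<close>), and \<open>x\<^sub>n\<close>, \<open>x\<^sub>k\<close> have distance at least \<open>2\<close>
  for \<open>n \<noteq> k\<close> (\<open>half_sums_even_separated\<close>). A nonexpansive function nevertheless oscillates asymptotically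
  by at most \<open>1\<close> along all these half sums (\<open>eventually_small_oscillation\<close>): limits along two
  families of blocks may be compared through edges in either order of the blocks, and these edges
  provide a perfect matching of the two pairs of types. Hence \<open>\<delta>\<close> is at most \<open>1\<close>, whereas \<open>ca\<close> is at
  least \<open>3\<close> along the interlaced sequence and at least \<open>2\<close> along each subsequence of \<open>(x\<^sub>n)\<close>.

  \<^item> Subtracting the half sum over the hubs of types \<open>0\<close> and \<open>1\<close> normalizes the \<open>x\<^sub>n\<close>. The resulting
  sequence is \<open>2\<close>-separated, but alternating sums of four of its terms (in increasing order) have norm
  at most \<open>3\<close>, so no subsequence is almost isometrically equivalent to the basis of \<open>\<ell>\<^sub>1\<close>.
\<close>

section \<open>The quantity ca and dual spaces\<close>

lemma ca_ge:
  assumes "\<And>p q. N (x p - x q) \<le> B" and "\<And>n. \<exists>p\<ge>n. \<exists>q\<ge>n. b \<le> N (x p - x q)"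
  shows "b \<le> ca N x"
  unfolding ca_def
proof (rule cINF_greatest)
  fix n
  obtain p q where pq: "p \<ge> n" "q \<ge> n" "b \<le> N (x p - x q)" using assms(2) by blast
  have "N (x p - x q) \<le> diam N (x ` {n..})"
    unfolding diam_def
    by (rule cSUP_upper2[where x="(x p, x q)"]) (use pq assms(1) in \<open>auto intro!: bdd_aboveI[where M=B]\<close>)
  then show "b \<le> diam N (x ` {n..})" using pq by simp
qed simp

lemma less_ca:
  assumes "\<And>p q. 0 \<le> N (x p - x q)" and "\<And>p q. N (x p - x q) \<le> B" and "b < ca N x"
  shows "\<exists>p\<ge>n. \<exists>q\<ge>n. b < N (x p - x q)"
proof (rule ccontr)
  assume neg: "\<not> ?thesis"
  have "ca N x \<le> diam N (x ` {n..})"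
    unfolding ca_def
  proof (rule cINF_lower[OF bdd_belowI2])
    fix k
    have "N (x k - x k) \<le> diam N (x ` {k..})"
      unfolding diam_def
      by (rule cSUP_upper2[where x="(x k, x k)"]) (use assms(2) in \<open>auto intro!: bdd_aboveI[where M=B]\<close>)
    then show "0 \<le> diam N (x ` {k..})" using assms(1)[of k k] by simp
  qed simp
  also have "\<dots> \<le> b"
    unfolding diam_def by (rule cSUP_least) (use neg in force)+
  finally show False using \<open>b < ca N x\<close> by simp
qed

lemma ca_le:
  assumes "\<And>p q. 0 \<le> N (x p - x q)" and "\<And>p q. N (x p - x q) \<le> B"
    and "\<And>p q. n \<le> p \<Longrightarrow> n \<le> q \<Longrightarrow> N (x p - x q) \<le> b"
  shows "ca N x \<le> b"
  using less_ca[of N x B b n] assms by (meson not_less)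

lemma ca_nonneg:
  assumes "\<And>p q. 0 \<le> N (x p - x q)" and "\<And>p q. N (x p - x q) \<le> B"
  shows "0 \<le> ca N x"
  by (rule ca_ge[where B=B]) (use assms in auto)

lemma dual_spaceI:
  assumes "\<And>x y. x \<in> V \<Longrightarrow> y \<in> V \<Longrightarrow> \<phi> (x + y) = \<phi> x + \<phi> y"
    and "\<And>a x. x \<in> V \<Longrightarrow> \<phi> (a *\<^sub>R x) = a * \<phi> x"
    and "\<And>x. x \<in> V \<Longrightarrow> \<bar>\<phi> x\<bar> \<le> B * N x"
    and "\<And>x. x \<notin> V \<Longrightarrow> \<phi> x = 0"
  shows "\<phi> \<in> dual_space V N"
  using assms unfolding dual_space_def by blast

lemma dual_spaceD:
  assumes "\<phi> \<in> dual_space V N"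
  shows "x \<in> V \<Longrightarrow> y \<in> V \<Longrightarrow> \<phi> (x + y) = \<phi> x + \<phi> y"
    and "x \<in> V \<Longrightarrow> \<phi> (a *\<^sub>R x) = a * \<phi> x"
    and "\<exists>B. \<forall>x\<in>V. \<bar>\<phi> x\<bar> \<le> B * N x"
    and "x \<notin> V \<Longrightarrow> \<phi> x = 0"
  using assms by (simp_all add: dual_space_def)

lemma subspace_dual_space: "subspace (dual_space V N)"
  unfolding subspace_def
proof (intro conjI ballI allI)
  show "0 \<in> dual_space V N" by (rule dual_spaceI[where B=0]) auto
next
  fix \<phi> \<psi> assume *: "\<phi> \<in> dual_space V N" "\<psi> \<in> dual_space V N"
  then obtain A B where "\<forall>x\<in>V. \<bar>\<phi> x\<bar> \<le> A * N x" "\<forall>x\<in>V. \<bar>\<psi> x\<bar> \<le> B * N x"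
    using dual_spaceD(3) by metis
  then have "\<bar>\<phi> x + \<psi> x\<bar> \<le> (A + B) * N x" if "x \<in> V" for x
    using that abs_triangle_ineq[of "\<phi> x" "\<psi> x"] by (fastforce simp: distrib_right)
  then show "\<phi> + \<psi> \<in> dual_space V N"
    by (intro dual_spaceI[where B="A + B"]) (simp_all add: dual_spaceD[OF *(1)] dual_spaceD[OF *(2)] algebra_simps)
next
  fix c \<phi> assume *: "\<phi> \<in> dual_space V N"
  then obtain A where "\<forall>x\<in>V. \<bar>\<phi> x\<bar> \<le> A * N x"
    using dual_spaceD(3) by metis
  then have "\<bar>c * \<phi> x\<bar> \<le> (\<bar>c\<bar> * A) * N x" if "x \<in> V" for x
    using that by (simp add: abs_mult mult.assoc mult_left_mono)
  then show "c *\<^sub>R \<phi> \<in> dual_space V N"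
    by (intro dual_spaceI[where B="\<bar>c\<bar> * A"])
      (simp_all add: scaleR_fun_def dual_spaceD[OF *] algebra_simps)
qed

lemma dual_space_diff:
  assumes "\<Xi> \<in> dual_space V N" "subspace V" "x \<in> V" "y \<in> V"
  shows "\<Xi> (x - y) = \<Xi> x - \<Xi> y"
  using dual_spaceD(1)[OF assms(1), of "x - y" y] assms by (simp add: subspace_diff)

lemma dual_ball_bound:
  assumes \<Xi>: "\<Xi> \<in> dual_ball V N" and v: "v \<in> V" and V: "subspace V"
    and pos: "\<And>v. v \<in> V \<Longrightarrow> 0 \<le> N v"
    and hom: "\<And>a v. v \<in> V \<Longrightarrow> N (a *\<^sub>R v) \<le> \<bar>a\<bar> * N v"
  shows "\<bar>\<Xi> v\<bar> \<le> N v"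
proof -
  have D: "\<Xi> \<in> dual_space V N" and le1: "dual_norm V N \<Xi> \<le> 1"
    using \<Xi> by (auto simp: dual_ball_def)
  from D obtain B where B: "\<And>x. x \<in> V \<Longrightarrow> \<bar>\<Xi> x\<bar> \<le> B * N x"
    and sc: "\<And>a x. x \<in> V \<Longrightarrow> \<Xi> (a *\<^sub>R x) = a * \<Xi> x"
    using dual_spaceD[OF D] by metis
  have unit: "\<bar>\<Xi> w\<bar> \<le> 1" if "w \<in> V" "N w \<le> 1" for w
  proof -
    have "\<bar>\<Xi> w\<bar> \<le> dual_norm V N \<Xi>"
      unfolding dual_norm_def
    proof (rule cSUP_upper[OF _ bdd_aboveI2])
      show "w \<in> {x \<in> V. N x \<le> 1}" using that by simp
      fix y assume y: "y \<in> {x \<in> V. N x \<le> 1}"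
      then have "\<bar>\<Xi> y\<bar> \<le> B * N y" using B by simp
      also have "\<dots> \<le> \<bar>B\<bar> * 1" using y pos[of y] by (intro mult_mono) auto
      finally show "\<bar>\<Xi> y\<bar> \<le> \<bar>B\<bar>" by simp
    qed
    then show ?thesis using le1 by simp
  qed
  show ?thesis
  proof (cases "N v = 0")
    case True
    then show ?thesis using B[OF v] by simp
  next
    case False
    then have N: "0 < N v" using pos[OF v] by simp
    have "N ((1 / N v) *\<^sub>R v) \<le> 1" using hom[OF v, of "1 / N v"] N by simp
    then have "\<bar>\<Xi> ((1 / N v) *\<^sub>R v)\<bar> \<le> 1" using unit v V by (simp add: subspace_scale)
    then show ?thesis using sc[OF v, of "1 / N v"] N by (simp add: abs_mult field_simps)
  qed
qed

section \<open>A gliding hump argument\<close>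

lemma sum_indicator_expansion:
  fixes \<Phi> :: "(nat \<Rightarrow> real) \<Rightarrow> real"
  assumes add: "\<And>f g. bounded (range f) \<Longrightarrow> bounded (range g) \<Longrightarrow> \<Phi> (\<lambda>i. f i + g i) = \<Phi> f + \<Phi> g"
    and scale: "\<And>a f. bounded (range f) \<Longrightarrow> \<Phi> (\<lambda>i. a * f i) = a * \<Phi> f"
  shows "\<Phi> (\<lambda>i. if i < n then g i else 0) = (\<Sum>i<n. g i * \<Phi> (indicator {i}))"
proof (induction n)
  case 0
  show ?case using scale[of "\<lambda>_. 0" 0] by simp
next
  case (Suc n)
  have b1: "bounded (range (\<lambda>i. if i < n then g i else 0))"
    by (rule finite_imp_bounded, rule finite_subset[of _ "insert 0 (g ` {..<n})"]) auto
  have b2: "bounded (range (indicator {n} :: nat \<Rightarrow> real))"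
    by (rule finite_imp_bounded, rule finite_subset[of _ "{0,1}"]) (auto simp: indicator_def)
  have b3: "bounded (range (\<lambda>i. g n * indicator {n} i))"
    by (rule finite_imp_bounded, rule finite_subset[of _ "{0,g n}"]) (auto simp: indicator_def)
  have "(\<lambda>i. if i < Suc n then g i else 0) = (\<lambda>i. (if i < n then g i else 0) + g n * indicator {n} i)"
    by (auto simp: fun_eq_iff indicator_def less_Suc_eq)
  then show ?case using add[OF b1 b3] scale[OF b2, of "g n"] Suc.IH by simp
qed

text \<open>
  A gliding hump argument for functionals on the bounded functions on the natural numbers that
  are small on functions supported far out, that is, for functionals given by elements of
  \<open>\<ell>\<^sub>1\<close>. If each functional has a \<open>[0, 1]\<close>-valued function on which it exceeds \<open>s\<close>, then
  a single \<open>[0, 1]\<close>-valued function serves infinitely many of them, up to an arbitrarily small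
  loss. The coordinates of the functionals and the given functions may be assumed to converge
  pointwise. The limit coordinates are summable, so they are negligible outside some \<open>{..<a}\<close>;
  the common function is the limit function on \<open>{..<a}\<close>, and further out it copies, on
  consecutive intervals, the functions belonging to a sparse sequence of indices.
\<close>
lemma gliding_hump:
  fixes \<Phi> :: "nat \<Rightarrow> (nat \<Rightarrow> real) \<Rightarrow> real"
  assumes add: "\<And>k f g. bounded (range f) \<Longrightarrow> bounded (range g) \<Longrightarrow> \<Phi> k (\<lambda>i. f i + g i) = \<Phi> k f + \<Phi> k g"
    and scale: "\<And>k a f. bounded (range f) \<Longrightarrow> \<Phi> k (\<lambda>i. a * f i) = a * \<Phi> k f"
    and bound: "\<And>k f. (\<And>i. \<bar>f i\<bar> \<le> 1) \<Longrightarrow> \<bar>\<Phi> k f\<bar> \<le> C"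
    and tail: "\<And>k e. 0 < e \<Longrightarrow> \<exists>n. \<forall>f. (\<forall>i. \<bar>f i\<bar> \<le> 1) \<and> (\<forall>i<n. f i = 0) \<longrightarrow> \<bar>\<Phi> k f\<bar> \<le> e"
    and h01: "\<And>k i. 0 \<le> h k i \<and> h k i \<le> 1"
    and hs: "\<And>k. s < \<Phi> k (h k)"
    and "s' < s"
  shows "\<exists>f. (\<forall>i. 0 \<le> f i \<and> f i \<le> 1) \<and> (\<forall>n. \<exists>k\<ge>n. s' < \<Phi> k f)"
proof -
  have C0: "0 \<le> C" using bound[of "\<lambda>_. 0" 0] by simp
  \<comment> \<open>The errors below add up to \<open>e * (C + 3)\<close>, which must be less than \<open>s - s'\<close>.\<close>
  define e where "e = (s - s') / (C + 4)"
  have e0: "0 < e" using \<open>s' < s\<close> C0 by (simp add: e_def)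
  define c where "c k i = \<Phi> k (indicator {i})" for k i
  have bnd: "bounded (range f)" if "\<And>i. \<bar>f i\<bar> \<le> 1" for f :: "nat \<Rightarrow> real"
    using that by (auto simp: bounded_iff)
  have expand: "\<Phi> k (\<lambda>i. if i < n then g i else 0) = (\<Sum>i<n. g i * c k i)" for k n g
    unfolding c_def by (rule sum_indicator_expansion) (use add scale in auto)
  have csum: "(\<Sum>i<n. \<bar>c k i\<bar>) \<le> C" for k n
  proof -
    have "(\<Sum>i<n. \<bar>c k i\<bar>) = (\<Sum>i<n. sgn (c k i) * c k i)"
      by (simp add: abs_sgn mult.commute)
    also have "\<dots> \<le> C"
    proof -
      have "\<bar>\<Phi> k (\<lambda>i. if i < n then sgn (c k i) else 0)\<bar> \<le> C"
        by (rule bound) (simp add: sgn_if)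
      then show ?thesis using expand[of k n "\<lambda>i. sgn (c k i)"] by simp
    qed
    finally show ?thesis .
  qed
  obtain r :: "nat \<Rightarrow> nat" where r: "strict_mono r"
    and rlim: "\<And>i. \<exists>l. (\<lambda>k. (c (r k) i, h (r k) i)) \<longlonglongrightarrow> l"
  proof -
    have cC: "\<bar>c k i\<bar> \<le> C" for k i
    proof -
      have "0 \<le> (\<Sum>j<i. \<bar>c k j\<bar>)" by (rule sum_nonneg) simp
      moreover have "(\<Sum>j<i. \<bar>c k j\<bar>) + \<bar>c k i\<bar> \<le> C" using csum[of k "Suc i"] by simp
      ultimately show ?thesis by linarith
    qed
    have "norm (c k i, h k i) \<le> C + 1" for k i
      using norm_Pair_le[of "c k i" "h k i"] cC[of k i] h01[of k i] by simp
    then show thesis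
      using function_convergent_subsequence[of "UNIV :: nat set" "\<lambda>k i. (c k i, h k i)" "C + 1"] that
      by auto
  qed
  then obtain l where l: "\<And>i. (\<lambda>k. (c (r k) i, h (r k) i)) \<longlonglongrightarrow> l i" by metis
  define u where "u i = fst (l i)" for i
  define g where "g i = snd (l i)" for i
  have clim: "(\<lambda>k. c (r k) i) \<longlonglongrightarrow> u i" for i
    using tendsto_fst[OF l[of i]] by (simp add: u_def)
  have hlim: "(\<lambda>k. h (r k) i) \<longlonglongrightarrow> g i" for i
    using tendsto_snd[OF l[of i]] by (simp add: g_def)
  have g01: "0 \<le> g i \<and> g i \<le> 1" for i
    using LIMSEQ_le_const[OF hlim[of i], of 0] LIMSEQ_le_const2[OF hlim[of i], of 1] h01 by blast
  have "(\<Sum>i<n. \<bar>u i\<bar>) \<le> C" for n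
    by (rule LIMSEQ_le_const2[of "\<lambda>k. \<Sum>i<n. \<bar>c (r k) i\<bar>"])
      (auto intro!: tendsto_intros clim csum)
  then have "summable (\<lambda>i. \<bar>u i\<bar>)"
    by (intro summableI_nonneg_bounded[where x=C]) auto
  then obtain a where a: "\<And>m n. a \<le> m \<Longrightarrow> \<bar>\<Sum>i=m..<n. \<bar>u i\<bar>\<bar> < e"
    using e0 unfolding summable_Cauchy real_norm_def by metis
  define tl where "tl k n \<longleftrightarrow> (\<forall>f. (\<forall>i. \<bar>f i\<bar> \<le> 1) \<and> (\<forall>i<n. f i = 0) \<longrightarrow> \<bar>\<Phi> k f\<bar> \<le> e)" for k n
  have tl_mono: "tl k n'" if "tl k n" "n \<le> n'" for k n n'
    using that unfolding tl_def by auto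
  define close where "close k n \<longleftrightarrow> (\<Sum>i<n. \<bar>c k i - u i\<bar>) < e \<and> (\<forall>i<a. \<bar>h k i - g i\<bar> < e)" for k n
  have ex_close: "\<exists>k>k0. close (r k) n" for n k0
  proof -
    have "(\<lambda>k. \<Sum>i<n. \<bar>c (r k) i - u i\<bar>) \<longlonglongrightarrow> (\<Sum>i<n. \<bar>u i - u i\<bar>)"
      by (intro tendsto_intros clim)
    then have "eventually (\<lambda>k. (\<Sum>i<n. \<bar>c (r k) i - u i\<bar>) < e) sequentially"
      using e0 by (simp add: order_tendsto_iff)
    moreover have "eventually (\<lambda>k. \<forall>i\<in>{..<a}. \<bar>h (r k) i - g i\<bar> < e) sequentially"
    proof (rule eventually_ball_finite)
      show "\<forall>i\<in>{..<a}. \<forall>\<^sub>F k in sequentially. \<bar>h (r k) i - g i\<bar> < e"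
        using hlim e0 tendstoD by (fastforce simp: dist_real_def)
    qed simp
    ultimately have "eventually (\<lambda>k. close (r k) n \<and> k > k0) sequentially"
      using eventually_gt_at_top[of k0] by eventually_elim (auto simp: close_def)
    then show ?thesis
      using eventually_happens'[OF sequentially_bot] by blast
  qed
  have ex_tl: "\<exists>n>n0. tl k n" for n0 k
  proof -
    obtain n where "tl k n" using tail[OF e0, of k] unfolding tl_def by blast
    then show ?thesis using tl_mono[of k n "max n (Suc n0)"] by (meson less_max_iff_disj lessI max.cobounded1)
  qed
  \<comment> \<open>Pairs of an index of the subsequence and a bound beyond which its functional is negligible;
      each functional is close to the limit up to the bound of its predecessor.\<close>
  obtain S :: "nat \<Rightarrow> nat \<times> nat" where
    S0: "\<And>j. a \<le> snd (S j) \<and> tl (r (fst (S j))) (snd (S j))" and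
    S1: "\<And>j. fst (S j) < fst (S (Suc j)) \<and> snd (S j) < snd (S (Suc j)) \<and>
             close (r (fst (S (Suc j)))) (snd (S j))"
  proof -
    have "\<exists>f. \<forall>j. (a \<le> snd (f j) \<and> tl (r (fst (f j))) (snd (f j))) \<and>
       (fst (f j) < fst (f (Suc j)) \<and> snd (f j) < snd (f (Suc j)) \<and>
             close (r (fst (f (Suc j)))) (snd (f j)))"
    proof (rule dependent_nat_choice[where P = "\<lambda>j x. a \<le> snd x \<and> tl (r (fst x)) (snd x)"
          and Q = "\<lambda>j x y. fst x < fst y \<and> snd x < snd y \<and> close (r (fst y)) (snd x)"])
      show "\<exists>x. a \<le> snd x \<and> tl (r (fst x)) (snd x)"
        using ex_tl[of a "r 0"] by (metis fst_conv snd_conv less_imp_le)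
      fix x :: "nat \<times> nat" and j :: nat
      assume x: "a \<le> snd x \<and> tl (r (fst x)) (snd x)"
      obtain k where "k > fst x" "close (r k) (snd x)" using ex_close by blast
      moreover obtain n where "n > snd x" "tl (r k) n" using ex_tl by blast
      ultimately show "\<exists>y. (a \<le> snd y \<and> tl (r (fst y)) (snd y)) \<and>
          fst x < fst y \<and> snd x < snd y \<and> close (r (fst y)) (snd x)"
        using x by (intro exI[of _ "(k, n)"]) auto
    qed
    then show thesis using that by blast
  qed
  define K where "K j = r (fst (S j))" for j
  define n where "n j = snd (S j)" for j
  have n_mono: "strict_mono n" unfolding n_def by (rule strict_monoI_Suc) (use S1 in blast)
  have K_mono: "strict_mono K" unfolding K_def
    using strict_mono_o[OF r, of "\<lambda>j. fst (S j)"] S1 by (auto simp: o_def strict_mono_Suc_iff)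
  have an: "a \<le> n j" and tlK: "tl (K j) (n j)" and closeK: "close (K (Suc j)) (n j)" for j
    using S0 S1 by (auto simp: K_def n_def)
  \<comment> \<open>For \<open>i\<close> between \<open>n j\<close> and \<open>n (Suc j)\<close> the least index is \<open>Suc j\<close>, so that \<open>f\<close> copies the
      function that belongs to \<open>K (Suc j)\<close>; the values below \<open>n 0\<close> do not matter.\<close>
  define f where "f i = (if i < a then g i else h (K (LEAST j. i < n j)) i)" for i
  have f01: "0 \<le> f i \<and> f i \<le> 1" for i using g01 h01 by (simp add: f_def)
  have fh: "f i = h (K (Suc j)) i" if "n j \<le> i" "i < n (Suc j)" for i j
  proof -
    have "(LEAST j. i < n j) = Suc j"
    proof (rule Least_equality)
      fix j' assume "i < n j'"
      then have "n j < n j'" using that by simp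
      then show "Suc j \<le> j'" using n_mono by (simp add: strict_mono_less)
    qed (use that in simp)
    then show ?thesis using that an[of j] by (simp add: f_def)
  qed
  have main: "s' < \<Phi> (K (Suc j)) f" for j
  proof -
    let ?k = "K (Suc j)"
    define d where "d i = f i - h ?k i" for i
    have d1: "\<bar>d i\<bar> \<le> 1" for i using f01[of i] h01[of ?k i] by (auto simp: d_def abs_le_iff)
    define d1 where "d1 i = (if i < n j then d i else 0)" for i
    define d2 where "d2 i = (if i < n j then 0 else d i)" for i
    have "f = (\<lambda>i. h ?k i + (d1 i + d2 i))" by (auto simp: d_def d1_def d2_def)
    moreover have "bounded (range (h ?k))" "bounded (range d1)" "bounded (range d2)"
      "bounded (range (\<lambda>i. d1 i + d2 i))"
      using h01 d1 by (intro bnd; auto simp: d1_def d2_def)+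
    ultimately have eq: "\<Phi> ?k f = \<Phi> ?k (h ?k) + (\<Phi> ?k d1 + \<Phi> ?k d2)"
      using add by metis
    have "\<bar>\<Phi> ?k d2\<bar> \<le> e"
      using tlK[of "Suc j"] d1 fh[of j] unfolding tl_def by (auto simp: d2_def d_def)
    moreover have "\<bar>\<Phi> ?k d1\<bar> \<le> e * C + 2 * e"
    proof -
      have "\<bar>\<Phi> ?k d1\<bar> \<le> (\<Sum>i<n j. \<bar>d i\<bar> * \<bar>c ?k i\<bar>)"
        unfolding d1_def expand using sum_abs[of "\<lambda>i. d i * c ?k i"] by (simp add: abs_mult)
      also have "\<dots> = (\<Sum>i<a. \<bar>d i\<bar> * \<bar>c ?k i\<bar>) + (\<Sum>i=a..<n j. \<bar>d i\<bar> * \<bar>c ?k i\<bar>)"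
        using sum.atLeastLessThan_concat[of 0 a "n j" "\<lambda>i. \<bar>d i\<bar> * \<bar>c ?k i\<bar>"] an[of j]
        by (simp add: atLeast0LessThan)
      also have "(\<Sum>i<a. \<bar>d i\<bar> * \<bar>c ?k i\<bar>) \<le> (\<Sum>i<a. e * \<bar>c ?k i\<bar>)"
      proof (rule sum_mono)
        fix i assume "i \<in> {..<a}"
        then have "\<bar>d i\<bar> < e" using closeK[of j] by (auto simp: d_def f_def close_def abs_minus_commute)
        then show "\<bar>d i\<bar> * \<bar>c ?k i\<bar> \<le> e * \<bar>c ?k i\<bar>" by (intro mult_right_mono) auto
      qed
      also have "\<dots> \<le> e * C" using csum[of ?k a] e0 by (simp add: sum_distrib_left[symmetric])
      also have "(\<Sum>i=a..<n j. \<bar>d i\<bar> * \<bar>c ?k i\<bar>) \<le> (\<Sum>i=a..<n j. \<bar>u i\<bar> + \<bar>c ?k i - u i\<bar>)"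
      proof (rule sum_mono)
        fix i
        have "\<bar>d i\<bar> * \<bar>c ?k i\<bar> \<le> 1 * \<bar>c ?k i\<bar>" using d1 by (intro mult_right_mono) auto
        then show "\<bar>d i\<bar> * \<bar>c ?k i\<bar> \<le> \<bar>u i\<bar> + \<bar>c ?k i - u i\<bar>" by linarith
      qed
      also have "\<dots> \<le> 2 * e"
      proof -
        have "(\<Sum>i=a..<n j. \<bar>c ?k i - u i\<bar>) \<le> (\<Sum>i<n j. \<bar>c ?k i - u i\<bar>)"
          by (rule sum_mono2) auto
        then show ?thesis using a[of a "n j"] closeK[of j] by (auto simp: sum.distrib close_def)
      qed
      finally show ?thesis by simp
    qed
    moreover have "e * (C + 4) = s - s'" using C0 by (simp add: e_def)
    ultimately show ?thesis using eq hs[of ?k] e0 by (simp add: algebra_simps)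
  qed
  have "\<exists>k\<ge>m. s' < \<Phi> k f" for m
    using main[of m] strict_mono_imp_increasing[OF K_mono, of "Suc m"] by (meson Suc_leD)
  with f01 show ?thesis by blast
qed

section \<open>Lipschitz-free spaces\<close>

text \<open>
  A metric whose points are all elements of the type \<open>'a\<close>, so that functions need no extension by
  zero. In this context \<open>F\<close> is the free space, \<open>FN\<close> its norm, and \<open>D\<close> the whole dual of \<open>Lip\<^sub>0\<close>.
\<close>
locale pointed_metric =
  fixes m :: "'a metric" and z :: 'a
  assumes mspace_UNIV: "mspace m = UNIV"
begin

abbreviation "D \<equiv> dual_space (Lip0 m z) (Lip_norm m)"
abbreviation "F \<equiv> free_space m z"
abbreviation "FN \<equiv> free_norm m z"

text \<open>
  The elements of the unit ball of \<open>Lip\<^sub>0\<close>: nonexpansive functions vanishing at the distinguished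
  point. Membership is stated without the infimum in the definition of the Lipschitz norm; it is
  equivalent because that infimum is attained.
\<close>
definition short :: "('a \<Rightarrow> real) \<Rightarrow> bool" where
  "short f \<longleftrightarrow> f z = 0 \<and> (\<forall>x y. \<bar>f x - f y\<bar> \<le> mdist m x y)"

lemma Lip0_iff: "f \<in> Lip0 m z \<longleftrightarrow> f z = 0 \<and> (\<exists>L. \<forall>x y. \<bar>f x - f y\<bar> \<le> L * mdist m x y)"
  by (auto simp: Lip0_def mspace_UNIV Lipschitz_continuous_map_def dist_real_def)

lemma Lip_norm_le:
  assumes "0 \<le> L" "\<And>x y. \<bar>f x - f y\<bar> \<le> L * mdist m x y"
  shows "Lip_norm m f \<le> L"
  unfolding Lip_norm_def mspace_UNIV
  by (rule cInf_lower) (use assms in \<open>auto intro!: bdd_belowI[of _ 0]\<close>)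

lemma short_iff: "short f \<longleftrightarrow> f \<in> Lip0 m z \<and> Lip_norm m f \<le> 1"
proof
  assume "short f"
  then show "f \<in> Lip0 m z \<and> Lip_norm m f \<le> 1"
    using Lip_norm_le[of 1 f] by (auto simp: short_def Lip0_iff intro!: exI[of _ 1])
next
  assume f: "f \<in> Lip0 m z \<and> Lip_norm m f \<le> 1"
  then obtain L where L: "\<forall>x y. \<bar>f x - f y\<bar> \<le> L * mdist m x y" by (auto simp: Lip0_iff)
  let ?S = "{L. 0 \<le> L \<and> (\<forall>x\<in>mspace m. \<forall>y\<in>mspace m. \<bar>f x - f y\<bar> \<le> L * mdist m x y)}"
  have "\<bar>L\<bar> \<in> ?S" using L by (auto intro!: order_trans[OF L[rule_format] mult_right_mono])
  then have ne: "?S \<noteq> {}" by blast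
  have "\<bar>f x - f y\<bar> \<le> mdist m x y" for x y
  proof (cases "mdist m x y = 0")
    case True
    then show ?thesis using L by (metis mult_zero_right)
  next
    case False
    then have pos: "0 < mdist m x y" using mdist_nonneg[of m x y] by linarith
    have "\<bar>f x - f y\<bar> / mdist m x y \<le> Lip_norm m f"
      unfolding Lip_norm_def
    proof (rule cInf_greatest[OF ne])
      fix L assume "L \<in> ?S"
      then have "\<bar>f x - f y\<bar> \<le> L * mdist m x y" by (simp add: mspace_UNIV)
      then show "\<bar>f x - f y\<bar> / mdist m x y \<le> L" using pos by (simp add: divide_le_eq)
    qed
    then have "\<bar>f x - f y\<bar> / mdist m x y \<le> 1" using f by simp
    then show ?thesis using pos by (simp add: divide_le_eq)
  qed
  then show "short f" using f by (simp add: short_def Lip0_iff)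
qed

lemma short_Lip0: "short f \<Longrightarrow> f \<in> Lip0 m z"
  by (simp add: short_iff)

lemma short_0: "short (\<lambda>_. 0)"
  by (simp add: short_def)

lemma free_norm_eq: "FN \<phi> = (SUP f\<in>{f. short f}. \<bar>\<phi> f\<bar>)"
  unfolding free_norm_def dual_norm_def by (simp add: short_iff)

lemma free_norm_upper:
  assumes "\<phi> \<in> D" "short f"
  shows "\<bar>\<phi> f\<bar> \<le> FN \<phi>"
proof -
  obtain B where B: "\<And>f. f \<in> Lip0 m z \<Longrightarrow> \<bar>\<phi> f\<bar> \<le> B * Lip_norm m f"
    using dual_spaceD(3)[OF assms(1)] by blast
  have "\<bar>\<phi> g\<bar> \<le> \<bar>B\<bar>" if "short g" for g
  proof -
    have g: "g \<in> Lip0 m z" "Lip_norm m g \<le> 1" using that by (auto simp: short_iff)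
    have "0 \<le> Lip_norm m g"
      unfolding Lip_norm_def
    proof (rule cInf_greatest)
      show "{L. 0 \<le> L \<and> (\<forall>x\<in>mspace m. \<forall>y\<in>mspace m. \<bar>g x - g y\<bar> \<le> L * mdist m x y)} \<noteq> {}"
        using that by (auto simp: short_def intro!: exI[of _ 1])
    qed simp
    then have "B * Lip_norm m g \<le> \<bar>B\<bar> * 1" using g by (intro mult_mono) auto
    then show ?thesis using B[OF g(1)] by simp
  qed
  then show ?thesis
    unfolding free_norm_eq using assms by (intro cSUP_upper bdd_aboveI2[where M="\<bar>B\<bar>"]) auto
qed

lemma free_norm_least: "(\<And>f. short f \<Longrightarrow> \<bar>\<phi> f\<bar> \<le> b) \<Longrightarrow> FN \<phi> \<le> b"
  unfolding free_norm_eq by (rule cSUP_least) (use short_0 in auto)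

lemma less_free_norm: "b < FN \<phi> \<Longrightarrow> \<exists>f. short f \<and> b < \<bar>\<phi> f\<bar>"
  using free_norm_least[of \<phi> b] by (meson not_less)

lemma free_norm_nonneg: "\<phi> \<in> D \<Longrightarrow> 0 \<le> FN \<phi>"
  using free_norm_upper[OF _ short_0, of \<phi>] by (meson abs_ge_zero order_trans)

lemma free_norm_triangle: "\<phi> \<in> D \<Longrightarrow> \<psi> \<in> D \<Longrightarrow> FN (\<phi> + \<psi>) \<le> FN \<phi> + FN \<psi>"
  by (rule free_norm_least) (smt (verit) free_norm_upper plus_fun_apply)

lemma free_norm_scale: "\<phi> \<in> D \<Longrightarrow> FN (a *\<^sub>R \<phi>) \<le> \<bar>a\<bar> * FN \<phi>"
  by (rule free_norm_least) (auto simp: scaleR_fun_def abs_mult intro!: mult_left_mono free_norm_upper)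

lemma free_norm_diff: "\<phi> \<in> D \<Longrightarrow> \<psi> \<in> D \<Longrightarrow> FN (\<phi> - \<psi>) \<le> FN \<phi> + FN \<psi>"
  by (rule free_norm_least) (smt (verit) free_norm_upper minus_apply)

lemma Lip0_add: "f \<in> Lip0 m z \<Longrightarrow> g \<in> Lip0 m z \<Longrightarrow> f + g \<in> Lip0 m z"
  unfolding Lip0_iff
proof safe
  fix K L assume "\<forall>x y. \<bar>f x - f y\<bar> \<le> K * mdist m x y" "\<forall>x y. \<bar>g x - g y\<bar> \<le> L * mdist m x y"
  then have "\<bar>(f + g) x - (f + g) y\<bar> \<le> (K + L) * mdist m x y" for x y
    by (smt (verit, best) distrib_right plus_fun_apply)
  then show "\<exists>L. \<forall>x y. \<bar>(f + g) x - (f + g) y\<bar> \<le> L * mdist m x y" by blast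
qed simp

lemma Lip0_scale: "f \<in> Lip0 m z \<Longrightarrow> a *\<^sub>R f \<in> Lip0 m z"
  unfolding Lip0_iff
proof safe
  fix K assume "\<forall>x y. \<bar>f x - f y\<bar> \<le> K * mdist m x y"
  then have "\<bar>(a *\<^sub>R f) x - (a *\<^sub>R f) y\<bar> \<le> (\<bar>a\<bar> * K) * mdist m x y" for x y
    by (simp add: scaleR_fun_def right_diff_distrib[symmetric] abs_mult mult.assoc mult_left_mono)
  then show "\<exists>L. \<forall>x y. \<bar>(a *\<^sub>R f) x - (a *\<^sub>R f) y\<bar> \<le> L * mdist m x y" by blast
qed (simp add: scaleR_fun_def)

abbreviation "ev \<equiv> evaluation m z"

lemma ev_apply [simp]: "f \<in> Lip0 m z \<Longrightarrow> ev p f = f p"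
  by (simp add: evaluation_def)

lemma ev_in_dual: "ev p \<in> D"
proof -
  have "\<bar>f p\<bar> \<le> mdist m p z * Lip_norm m f" if f: "f \<in> Lip0 m z" for f
  proof -
    obtain L where L: "\<forall>x y. \<bar>f x - f y\<bar> \<le> L * mdist m x y" and fz: "f z = 0"
      using f by (auto simp: Lip0_iff)
    let ?S = "{L. 0 \<le> L \<and> (\<forall>x\<in>mspace m. \<forall>y\<in>mspace m. \<bar>f x - f y\<bar> \<le> L * mdist m x y)}"
    have ne: "\<bar>L\<bar> \<in> ?S" using L by (auto intro!: order_trans[OF L[rule_format] mult_right_mono])
    show ?thesis
    proof (cases "mdist m p z = 0")
      case True
      then have "p = z" by (simp add: mspace_UNIV)
      then show ?thesis unfolding True using fz by simp
    next
      case False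
      then have pos: "0 < mdist m p z" using mdist_nonneg[of m p z] by linarith
      have "\<bar>f p\<bar> / mdist m p z \<le> Lip_norm m f"
        unfolding Lip_norm_def
      proof (rule cInf_greatest)
        show "?S \<noteq> {}" using ne by blast
        fix L assume "L \<in> ?S"
        then have "\<bar>f p - f z\<bar> \<le> L * mdist m p z" by (auto simp: mspace_UNIV)
        then show "\<bar>f p\<bar> / mdist m p z \<le> L" using pos fz by (simp add: divide_le_eq)
      qed
      then show ?thesis using pos by (simp add: divide_le_eq mult.commute)
    qed
  qed
  then show ?thesis
    unfolding dual_space_def evaluation_def
    using Lip0_add Lip0_scale by (auto simp: scaleR_fun_def)
qed

lemma free_space_subset_dual: "F \<subseteq> D"
  by (auto simp: free_space_def)

lemma span_ev_subset: "span (range ev) \<subseteq> F"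
proof
  fix \<phi> assume \<phi>: "\<phi> \<in> span (range ev)"
  have "span (range ev) \<subseteq> D"
    by (rule span_minimal) (use ev_in_dual subspace_dual_space in auto)
  moreover have "FN (\<phi> - \<phi>) \<le> 0" by (rule free_norm_least) simp
  then have "\<exists>\<psi>\<in>span (range ev). FN (\<phi> - \<psi>) < e" if "0 < e" for e
    using \<phi> that by (intro bexI[of _ \<phi>]) auto
  ultimately show "\<phi> \<in> F" using \<phi> by (auto simp: free_space_def mspace_UNIV)
qed

lemma subspace_free_space: "subspace F"
  unfolding subspace_def
proof (intro conjI ballI allI)
  have SD: "span (range ev) \<subseteq> D" using span_ev_subset free_space_subset_dual by blast
  show "0 \<in> F" using span_ev_subset span_zero by blast
  {
    fix \<phi> \<psi> assume A: "\<phi> \<in> F" "\<psi> \<in> F"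
    show "\<phi> + \<psi> \<in> F"
      unfolding free_space_def mspace_UNIV
    proof (intro CollectI conjI allI impI)
      show "\<phi> + \<psi> \<in> D" using A free_space_subset_dual subspace_add[OF subspace_dual_space] by blast
      fix e :: real assume "0 < e"
      then have "0 < e / 2" by simp
      then obtain \<phi>' \<psi>' where *: "\<phi>' \<in> span (range ev)" "\<psi>' \<in> span (range ev)"
          "FN (\<phi> - \<phi>') < e / 2" "FN (\<psi> - \<psi>') < e / 2"
        using A unfolding free_space_def mspace_UNIV by blast
      have "\<phi> - \<phi>' \<in> D" "\<psi> - \<psi>' \<in> D"
        using A * SD free_space_subset_dual subspace_diff[OF subspace_dual_space] by blast+
      then have "FN ((\<phi> - \<phi>') + (\<psi> - \<psi>')) < e"
        using free_norm_triangle * by fastforce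
      moreover have "(\<phi> - \<phi>') + (\<psi> - \<psi>') = (\<phi> + \<psi>) - (\<phi>' + \<psi>')" by simp
      ultimately show "\<exists>\<theta>\<in>span (range ev). FN (\<phi> + \<psi> - \<theta>) < e"
        using * span_add by metis
    qed
  next
    fix c \<phi> assume A: "\<phi> \<in> F"
    show "c *\<^sub>R \<phi> \<in> F"
      unfolding free_space_def mspace_UNIV
    proof (intro CollectI conjI allI impI)
      show "c *\<^sub>R \<phi> \<in> D" using A free_space_subset_dual subspace_scale[OF subspace_dual_space] by blast
      fix e :: real assume e: "0 < e"
      then have "0 < e / (\<bar>c\<bar> + 1)" by simp
      then obtain \<phi>' where *: "\<phi>' \<in> span (range ev)" "FN (\<phi> - \<phi>') < e / (\<bar>c\<bar> + 1)"
        using A unfolding free_space_def mspace_UNIV by blast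
      have diff: "\<phi> - \<phi>' \<in> D"
        using A * SD free_space_subset_dual subspace_diff[OF subspace_dual_space] by blast
      have "FN (c *\<^sub>R (\<phi> - \<phi>')) \<le> \<bar>c\<bar> * FN (\<phi> - \<phi>')" using free_norm_scale[OF diff] .
      also have "\<dots> \<le> (\<bar>c\<bar> + 1) * FN (\<phi> - \<phi>')" using free_norm_nonneg[OF diff] by (intro mult_right_mono) auto
      also have "\<dots> < e" using *(2) by (simp add: field_simps add_pos_nonneg)
      finally have "FN (c *\<^sub>R \<phi> - c *\<^sub>R \<phi>') < e" by (simp add: scaleR_diff_right)
      then show "\<exists>\<theta>\<in>span (range ev). FN (c *\<^sub>R \<phi> - \<theta>) < e"
        using * span_scale by blast
    qed
  }
qed

lemma ev_in_free: "ev p \<in> F"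
  using span_ev_subset span_base by blast

lemma dual_ball_free_bound:
  assumes "\<Xi> \<in> dual_ball F FN" "v \<in> F"
  shows "\<bar>\<Xi> v\<bar> \<le> FN v"
  by (rule dual_ball_bound[OF assms subspace_free_space])
    (use free_space_subset_dual free_norm_nonneg free_norm_scale in blast)+

text \<open>
  Each element of the unit ball of \<open>Lip\<^sub>0\<close> is a functional on the free space by evaluation.
\<close>
lemma point_evaluation_in_dual_ball:
  assumes "short f"
  shows "(\<lambda>v. if v \<in> F then v f else 0) \<in> dual_ball F FN" (is "?\<Xi> \<in> _")
proof -
  have le: "\<bar>v f\<bar> \<le> FN v" if "v \<in> F" for v
    using free_norm_upper assms that free_space_subset_dual by blast
  have "?\<Xi> \<in> dual_space F FN"
    unfolding dual_space_def
    using le subspace_add[OF subspace_free_space] subspace_scale[OF subspace_free_space]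
    by (auto simp: scaleR_fun_def intro!: exI[of _ 1])
  moreover have "dual_norm F FN ?\<Xi> \<le> 1"
    unfolding dual_norm_def
  proof (rule cSUP_least)
    have "FN 0 \<le> 1" by (rule free_norm_least) simp
    then show "{v \<in> F. FN v \<le> 1} \<noteq> {}" using subspace_0[OF subspace_free_space] by blast
  qed (use le in fastforce)
  ultimately show ?thesis by (simp add: dual_ball_def)
qed

lemma bounded_seq_diff:
  assumes "bounded_seq F FN x"
  obtains B where "\<And>p q. 0 \<le> FN (x p - x q)" "\<And>p q. FN (x p - x q) \<le> B" "\<And>p q. x p - x q \<in> F"
proof -
  obtain B where B: "\<And>n. FN (x n) \<le> B" and F: "\<And>n. x n \<in> F" using assms by (auto simp: bounded_seq_def)
  have d: "x p - x q \<in> F" for p q using F subspace_diff[OF subspace_free_space] by blast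
  have "FN (x p - x q) \<le> 2 * B" for p q
    using free_norm_diff[of "x p" "x q"] B[of p] B[of q] F free_space_subset_dual by fastforce
  then show thesis using that d free_norm_nonneg free_space_subset_dual by blast
qed

lemma dual_ball_diff_bound:
  assumes "\<Xi> \<in> dual_ball F FN" "v \<in> F" "w \<in> F"
  shows "\<bar>\<Xi> v - \<Xi> w\<bar> \<le> FN (v - w)"
  using dual_ball_free_bound[of \<Xi> "v - w"] dual_space_diff[OF _ subspace_free_space, of \<Xi> FN v w]
    subspace_diff[OF subspace_free_space] assms by (simp add: dual_ball_def)

lemma delta_upper:
  assumes x: "bounded_seq F FN x" and \<Xi>: "\<Xi> \<in> dual_ball F FN"
  shows "ca abs (\<Xi> \<circ> x) \<le> delta F FN x"
  unfolding delta_def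
proof -
  obtain B where B: "\<And>p q. FN (x p - x q) \<le> B" using bounded_seq_diff[OF x] by metis
  have *: "ca abs (\<Xi> \<circ> x) \<le> B" if \<Xi>: "\<Xi> \<in> dual_ball F FN" for \<Xi>
  proof -
    have "\<bar>(\<Xi> \<circ> x) p - (\<Xi> \<circ> x) q\<bar> \<le> B" for p q
      using dual_ball_diff_bound[OF \<Xi>, of "x p" "x q"] B[of p q] x by (simp add: bounded_seq_def)
    then show ?thesis by (intro ca_le[where B=B and n=0]) auto
  qed
  show "ca abs (\<Xi> \<circ> x) \<le> (SUP \<Xi>\<in>dual_ball F FN. ca abs (\<Xi> \<circ> x))"
    by (rule cSUP_upper[OF \<Xi> bdd_aboveI2]) (rule *)
qed

lemma delta_upper_point:
  assumes x: "bounded_seq F FN x" and f: "short f"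
  shows "ca abs (\<lambda>n. x n f) \<le> delta F FN x"
proof -
  have "(\<lambda>v. if v \<in> F then v f else 0) \<circ> x = (\<lambda>n. x n f)"
    using x by (auto simp: bounded_seq_def fun_eq_iff)
  then show ?thesis using delta_upper[OF x point_evaluation_in_dual_ball[OF f]] by simp
qed

lemma delta_nonneg:
  assumes x: "bounded_seq F FN x"
  shows "0 \<le> delta F FN x"
proof -
  have "ca abs (\<lambda>n. 0::real) \<ge> 0" by (rule ca_nonneg[where B=0]) auto
  moreover have "(\<lambda>n. x n (\<lambda>_. 0)) = (\<lambda>n. 0)"
  proof
    fix n
    have "x n \<in> D" using x free_space_subset_dual by (auto simp: bounded_seq_def)
    then have "x n (0 *\<^sub>R (\<lambda>_. 0)) = 0 * x n (\<lambda>_. 0)"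
      using short_Lip0[OF short_0] unfolding dual_space_def by blast
    then show "x n (\<lambda>_. 0) = 0" by (simp add: zero_fun_def)
  qed
  ultimately show ?thesis using delta_upper_point[OF x short_0] by simp
qed

lemma delta_least:
  assumes "\<And>\<Xi>. \<Xi> \<in> dual_ball F FN \<Longrightarrow> ca abs (\<Xi> \<circ> x) \<le> b"
  shows "delta F FN x \<le> b"
  unfolding delta_def by (rule cSUP_least) (use assms point_evaluation_in_dual_ball[OF short_0] in auto)

end

section \<open>Bounded uniformly separated metrics\<close>

text \<open>
  A metric on the natural numbers that is uniformly separated and bounded. Every function of
  oscillation at most \<open>1\<close> is nonexpansive and every nonexpansive function has oscillation at most
  \<open>R\<close>, so that the free norm and the norm dual to the oscillation differ at most by the factor \<open>R\<close>.
\<close>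
locale separated_metric = pointed_metric m z for m :: "nat metric" and z +
  fixes R :: real
  assumes separated: "x \<noteq> y \<Longrightarrow> 1 \<le> mdist m x y"
    and diameter: "mdist m x y \<le> R"
begin

text \<open>
  Subtracting the value at the distinguished point turns a bounded function into an element of
  \<open>Lip\<^sub>0\<close>. An element of the free space thus acts on all bounded functions, annihilating constants.
\<close>
definition rebase :: "(nat \<Rightarrow> real) \<Rightarrow> nat \<Rightarrow> real" where
  "rebase f = (\<lambda>i. f i - f z)"

lemma R_ge_1: "1 \<le> R"
  using separated[of 0 1] diameter[of 0 1] by simp

lemma short_rebase: "(\<And>x y. \<bar>f x - f y\<bar> \<le> mdist m x y) \<Longrightarrow> short (rebase f)"
  by (simp add: short_def rebase_def)

lemma short_rebase_osc:
  assumes "\<And>x y. \<bar>f x - f y\<bar> \<le> 1"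
  shows "short (rebase f)"
proof (rule short_rebase)
  fix x y show "\<bar>f x - f y\<bar> \<le> mdist m x y"
    using assms[of x y] separated[of x y] by (cases "x = y") auto
qed

lemma rebase_Lip0:
  assumes "bounded (range f)"
  shows "rebase f \<in> Lip0 m z"
proof -
  obtain B where B: "\<And>i. \<bar>f i\<bar> \<le> B" using assms by (auto simp: bounded_iff)
  have "\<bar>rebase f x - rebase f y\<bar> \<le> (2 * B) * mdist m x y" for x y
  proof (cases "x = y")
    case False
    have "\<bar>rebase f x - rebase f y\<bar> \<le> 2 * B * 1"
      using B[of x] B[of y] by (simp add: rebase_def)
    also have "\<dots> \<le> 2 * B * mdist m x y"
      using B[of x] separated[OF False] by (intro mult_left_mono) auto
    finally show ?thesis .
  qed (use B[of x] in auto)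
  then show ?thesis unfolding Lip0_iff by (auto simp: rebase_def)
qed

lemma rebase_bound:
  assumes "\<phi> \<in> D" "\<And>i. \<bar>f i\<bar> \<le> 1"
  shows "\<bar>\<phi> (rebase f)\<bar> \<le> 2 * FN \<phi>"
proof -
  let ?g = "rebase (\<lambda>i. f i / 2)"
  have "\<bar>f x / 2 - f y / 2\<bar> \<le> 1" for x y
    using assms(2)[of x] assms(2)[of y] by (auto simp: abs_le_iff)
  then have g: "short ?g" by (rule short_rebase_osc)
  have "rebase f = 2 *\<^sub>R ?g" by (auto simp: rebase_def scaleR_fun_def)
  then have "\<phi> (rebase f) = 2 * \<phi> ?g"
    using dual_spaceD(2)[OF assms(1) short_Lip0[OF g]] by simp
  then show ?thesis using free_norm_upper[OF assms(1) g] by simp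
qed

lemma span_finite_support:
  assumes "\<psi> \<in> span (range ev)"
  shows "\<exists>n. \<forall>f\<in>Lip0 m z. (\<forall>i<n. f i = 0) \<longrightarrow> \<psi> f = 0"
  using assms
proof (induction rule: span_induct_alt)
  case base
  show ?case by auto
next
  case (step c \<phi> \<psi>)
  then obtain p n where "\<phi> = ev p" and n: "\<forall>f\<in>Lip0 m z. (\<forall>i<n. f i = 0) \<longrightarrow> \<psi> f = 0" by blast
  then show ?case
    by (intro exI[of _ "max n (Suc p)"]) (auto simp: scaleR_fun_def)
qed

text \<open>
  Elements of the free space are limits of finitely supported ones, hence negligible on functions
  that are supported far out.
\<close>
lemma free_space_tail:
  assumes \<phi>: "\<phi> \<in> F" and "0 < e"
  shows "\<exists>n. \<forall>f. (\<forall>i. \<bar>f i\<bar> \<le> 1) \<and> (\<forall>i<n. f i = 0) \<longrightarrow> \<bar>\<phi> (rebase f)\<bar> \<le> e"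
proof -
  obtain \<psi> where \<psi>: "\<psi> \<in> span (range ev)" "FN (\<phi> - \<psi>) < e / 2"
    using assms by (auto simp: free_space_def mspace_UNIV dest!: spec[of _ "e / 2"])
  obtain n where n: "\<And>f. f \<in> Lip0 m z \<Longrightarrow> (\<forall>i<n. f i = 0) \<Longrightarrow> \<psi> f = 0"
    using span_finite_support[OF \<psi>(1)] by blast
  have D: "\<phi> - \<psi> \<in> D"
    using \<phi> \<psi>(1) span_ev_subset free_space_subset_dual subspace_diff[OF subspace_dual_space] by blast
  have "\<bar>\<phi> (rebase f)\<bar> \<le> e" if f: "\<forall>i. \<bar>f i\<bar> \<le> 1" "\<forall>i < max n (Suc z). f i = 0" for f
  proof -
    have "bounded (range f)" using f by (auto simp: bounded_iff)
    then have "\<psi> (rebase f) = 0" using f by (intro n rebase_Lip0) (auto simp: rebase_def)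
    then have "\<bar>\<phi> (rebase f)\<bar> = \<bar>(\<phi> - \<psi>) (rebase f)\<bar>" by simp
    also have "\<dots> \<le> 2 * FN (\<phi> - \<psi>)" using f by (intro rebase_bound[OF D]) auto
    finally show ?thesis using \<psi>(2) by simp
  qed
  then show ?thesis by blast
qed

lemma normalised_norming_function:
  assumes "\<phi> \<in> D" "R * s < FN \<phi>"
  shows "\<exists>h. (\<forall>i. 0 \<le> h i \<and> h i \<le> 1) \<and> s < \<bar>\<phi> (rebase h)\<bar>"
proof -
  obtain f where f: "short f" "R * s < \<bar>\<phi> f\<bar>" using less_free_norm assms by blast
  have osc: "f i - f j \<le> R" for i j
    using f(1) diameter[of i j] unfolding short_def by (smt (verit))
  define c where "c = Inf (range f)"
  have bb: "bdd_below (range f)" using osc[of 0] by (intro bdd_belowI2[where m="f 0 - R"]) (simp add: algebra_simps)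
  have lo: "c \<le> f i" for i unfolding c_def using bb by (intro cInf_lower) auto
  have hi: "f i - R \<le> c" for i unfolding c_def by (rule cInf_greatest) (use osc[of i] in \<open>auto simp: algebra_simps\<close>)
  define h where "h i = (f i - c) / R" for i
  have "rebase h = (1 / R) *\<^sub>R f"
    using f(1) by (auto simp: rebase_def h_def scaleR_fun_def short_def diff_divide_distrib)
  then have "\<bar>\<phi> (rebase h)\<bar> = \<bar>\<phi> f\<bar> / R"
    using dual_spaceD(2)[OF assms(1) short_Lip0[OF f(1)]] R_ge_1 by simp
  moreover have "0 \<le> h i \<and> h i \<le> 1" for i
    using lo[of i] hi[of i] R_ge_1 by (simp add: h_def divide_le_eq)
  ultimately show ?thesis
    using f(2) R_ge_1 by (intro exI[of _ h]) (simp add: less_divide_eq mult.commute)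
qed

text \<open>
  If the difference of two members of the sequence has norm greater than \<open>R * s\<close>, then it exceeds
  \<open>s\<close> on some \<open>[0, 1]\<close>-valued function, up to the order of the two members. The gliding hump lemma provides one such function for infinitely many
  of these differences, and evaluation there is a functional of norm at most one.
\<close>
theorem Schur_property_diameter: "Schur_property R F FN"
  unfolding Schur_property_def
proof (intro allI impI)
  fix x assume x: "bounded_seq F FN x"
  obtain B where B: "\<And>p q. 0 \<le> FN (x p - x q)" "\<And>p q. FN (x p - x q) \<le> B"
    and diffF: "\<And>p q. x p - x q \<in> F"
    using bounded_seq_diff[OF x] by metis
  have diffD: "x p - x q \<in> D" for p q using diffF free_space_subset_dual by blast
  show "ca FN x \<le> R * delta F FN x"
  proof (rule ccontr)
    assume "\<not> ?thesis"
    then have "delta F FN x < ca FN x / R" using R_ge_1 by (simp add: less_divide_eq mult.commute)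
    then obtain s where s: "delta F FN x < s" "s < ca FN x / R" using dense by blast
    then obtain s' where s': "delta F FN x < s'" "s' < s" using dense by blast
    have Rs: "R * s < ca FN x" using s(2) R_ge_1 by (simp add: less_divide_eq mult.commute)
    have "\<exists>p q h. p \<ge> n \<and> q \<ge> n \<and> (\<forall>i. 0 \<le> h i \<and> h i \<le> 1) \<and> s < (x p - x q) (rebase h)" for n
    proof -
      obtain p q where pq: "p \<ge> n" "q \<ge> n" "R * s < FN (x p - x q)"
        using less_ca[OF B Rs] by blast
      obtain h where h: "\<forall>i. 0 \<le> h i \<and> h i \<le> 1" "s < \<bar>(x p - x q) (rebase h)\<bar>"
        using normalised_norming_function[OF diffD pq(3)] by blast
      show ?thesis
      proof (cases "0 \<le> (x p - x q) (rebase h)")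
        case True
        then have "s < (x p - x q) (rebase h)" using h(2) by simp
        then show ?thesis using pq h(1) by blast
      next
        case False
        then have "s < (x q - x p) (rebase h)" using h(2) by simp
        then show ?thesis using pq h(1) by blast
      qed
    qed
    then obtain P Q h where PQ: "\<And>n. n \<le> P n" "\<And>n. n \<le> Q n"
      and h: "\<And>n i. 0 \<le> h n i \<and> h n i \<le> 1"
      and hs: "\<And>n. s < (x (P n) - x (Q n)) (rebase (h n))"
      by metis
    have "\<exists>f. (\<forall>i. 0 \<le> f i \<and> f i \<le> 1) \<and> (\<forall>n. \<exists>k\<ge>n. s' < (x (P k) - x (Q k)) (rebase f))"
    proof (rule gliding_hump[where C="2 * B" and h=h and s=s])
      fix k and f g :: "nat \<Rightarrow> real"
      assume "bounded (range f)" "bounded (range g)"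
      moreover have "rebase (\<lambda>i. f i + g i) = rebase f + rebase g" by (auto simp: rebase_def)
      ultimately show "(x (P k) - x (Q k)) (rebase (\<lambda>i. f i + g i)) =
          (x (P k) - x (Q k)) (rebase f) + (x (P k) - x (Q k)) (rebase g)"
        using dual_spaceD(1)[OF diffD] rebase_Lip0 by metis
    next
      fix k a and f :: "nat \<Rightarrow> real"
      assume "bounded (range f)"
      moreover have "rebase (\<lambda>i. a * f i) = a *\<^sub>R rebase f"
        by (auto simp: rebase_def scaleR_fun_def algebra_simps)
      ultimately show "(x (P k) - x (Q k)) (rebase (\<lambda>i. a * f i)) = a * (x (P k) - x (Q k)) (rebase f)"
        using dual_spaceD(2)[OF diffD] rebase_Lip0 by metis
    next
      fix k and f :: "nat \<Rightarrow> real"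
      assume "\<And>i. \<bar>f i\<bar> \<le> 1"
      then have "\<bar>(x (P k) - x (Q k)) (rebase f)\<bar> \<le> 2 * FN (x (P k) - x (Q k))"
        by (rule rebase_bound[OF diffD])
      also have "\<dots> \<le> 2 * B" using B(2) by simp
      finally show "\<bar>(x (P k) - x (Q k)) (rebase f)\<bar> \<le> 2 * B" .
    next
      fix k and e :: real assume "0 < e"
      then show "\<exists>n. \<forall>f. (\<forall>i. \<bar>f i\<bar> \<le> 1) \<and> (\<forall>i<n. f i = 0) \<longrightarrow> \<bar>(x (P k) - x (Q k)) (rebase f)\<bar> \<le> e"
        by (rule free_space_tail[OF diffF])
    qed (use h hs s' in auto)
    then obtain f where f: "\<And>i. 0 \<le> f i \<and> f i \<le> 1"
      and fs: "\<And>n. \<exists>k\<ge>n. s' < (x (P k) - x (Q k)) (rebase f)" by blast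
    have sh: "short (rebase f)"
    proof (rule short_rebase_osc)
      fix a b show "\<bar>f a - f b\<bar> \<le> 1" using f[of a] f[of b] by (simp add: abs_le_iff)
    qed
    have "s' \<le> ca abs (\<lambda>n. x n (rebase f))"
    proof (rule ca_ge)
      fix p q
      show "\<bar>x p (rebase f) - x q (rebase f)\<bar> \<le> B"
        using free_norm_upper[OF diffD sh, of p q] B(2)[of p q] by simp
    next
      fix n
      obtain k where "k \<ge> n" "s' < (x (P k) - x (Q k)) (rebase f)" using fs by blast
      then show "\<exists>p\<ge>n. \<exists>q\<ge>n. s' \<le> \<bar>x p (rebase f) - x q (rebase f)\<bar>"
        using PQ[of k] by (intro exI[of _ "P k"] exI[of _ "Q k"] conjI) auto
    qed
    also have "\<dots> \<le> delta F FN x" by (rule delta_upper_point[OF x sh])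
    finally show False using s' by simp
  qed
qed

end

section \<open>The graph\<close>

lemma path_dist_le: "(x, y) \<in> E ^^ n \<Longrightarrow> path_dist E x y \<le> n"
  unfolding path_dist_def by (rule Least_le)

lemma path_dist_relpow: "(x, y) \<in> E\<^sup>* \<Longrightarrow> (x, y) \<in> E ^^ path_dist E x y"
  unfolding path_dist_def by (rule LeastI_ex) (simp add: rtrancl_power)

lemma sym_relpow: "sym E \<Longrightarrow> (x, y) \<in> E ^^ n \<Longrightarrow> (y, x) \<in> E ^^ n"
proof (induction n arbitrary: y)
  case (Suc n)
  then obtain w where "(x, w) \<in> E ^^ n" "(w, y) \<in> E" by auto
  then show ?case using Suc by (metis relpow_Suc_I2 symD)
qed simp

lemma Metric_space_path_dist:
  assumes "connected_graph V E"
  shows "Metric_space V (\<lambda>x y. real (path_dist E x y))"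
proof -
  have "\<forall>x\<in>V. \<forall>y\<in>V. (x, y) \<in> E\<^sup>*" and "sym E"
    using assms by (simp_all add: connected_graph_def)
  then have reach: "(x, y) \<in> E ^^ path_dist E x y" if "x \<in> V" "y \<in> V" for x y
    using that by (intro path_dist_relpow) simp
  show ?thesis
  proof
  show "0 \<le> real (path_dist E x y)" for x y by simp
  have iff: "(x, y) \<in> E ^^ n \<longleftrightarrow> (y, x) \<in> E ^^ n" for x y n 
    using sym_relpow[OF \<open>sym E\<close>, of x y n] sym_relpow[OF \<open>sym E\<close>, of y x n] by (rule iffI)
  show "real (path_dist E x y) = real (path_dist E y x)" for x y
    unfolding path_dist_def by (simp only: iff[of x y])
  show "real (path_dist E x y) = 0 \<longleftrightarrow> x = y" if "x \<in> V" "y \<in> V" for x y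
  proof
    assume "real (path_dist E x y) = 0"
    then show "x = y" using reach[OF that] by simp
  next
    assume "x = y"
    then show "real (path_dist E x y) = 0" using path_dist_le[of x y 0 E] by simp
  qed
  show "real (path_dist E x w) \<le> real (path_dist E x y) + real (path_dist E y w)"
    if "x \<in> V" "y \<in> V" "w \<in> V" for x y w
  proof -
    have "(x, w) \<in> E ^^ (path_dist E x y + path_dist E y w)"
      unfolding relpow_add by (rule relcompI) (rule reach that)+
    then have "path_dist E x w \<le> path_dist E x y + path_dist E y w" by (rule path_dist_le)
    then show ?thesis by simp
  qed
qed
qed

lemma path_dist_ge_2:
  assumes "(x, y) \<in> E\<^sup>*" "x \<noteq> y" "(x, y) \<notin> E"
  shows "2 \<le> path_dist E x y"
proof (rule ccontr)
  assume "\<not> ?thesis"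
  then have "path_dist E x y = 0 \<or> path_dist E x y = 1" by auto
  then show False using path_dist_relpow[OF assms(1)] assms by auto
qed

lemma path_dist_ge_3:
  assumes "(x, y) \<in> E\<^sup>*" "x \<noteq> y" "(x, y) \<notin> E" "\<And>w. (x, w) \<in> E \<Longrightarrow> (w, y) \<notin> E"
  shows "3 \<le> path_dist E x y"
proof (rule ccontr)
  assume "\<not> ?thesis"
  then have "path_dist E x y = 2" using path_dist_ge_2[OF assms(1-3)] by simp
  then show False using path_dist_relpow[OF assms(1)] assms by (auto simp: numeral_2_eq_2)
qed

text \<open>
  The vertex \<open>4 * n + t\<close> with \<open>t < 4\<close> is the vertex of type \<open>t\<close> in block \<open>n\<close>. The four vertices of
  block \<open>0\<close> are hubs: they are mutually adjacent, and the hub of type \<open>t\<close> is adjacent to all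
  vertices of type \<open>t\<close>. Between different positive blocks, type \<open>t\<close> of the earlier block is adjacent
  to type \<open>t + 1\<close> modulo \<open>4\<close> of the later one.
\<close>
definition adj :: "nat \<Rightarrow> nat \<Rightarrow> bool" where
  "adj p q \<longleftrightarrow>
     (if p div 4 = q div 4 then p div 4 = 0 \<and> p mod 4 \<noteq> q mod 4
      else if p div 4 = 0 \<or> q div 4 = 0 then p mod 4 = q mod 4
      else if p div 4 < q div 4 then q mod 4 = Suc (p mod 4) mod 4
      else p mod 4 = Suc (q mod 4) mod 4)"

definition edges :: "(nat \<times> nat) set" where
  "edges = {(p, q). adj p q}"

lemma adj_sym: "adj p q \<longleftrightarrow> adj q p"
  by (auto simp: adj_def)

lemma adj_irrefl: "\<not> adj p p"
  by (simp add: adj_def)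

lemma adj_hub: "p = p mod 4 \<or> adj p (p mod 4)"
  by (auto simp: adj_def)

lemma adj_hubs: "p mod 4 = q mod 4 \<or> adj (p mod 4) (q mod 4)"
  by (auto simp: adj_def)

lemma adj_forward:
  assumes "4 \<le> p" "p div 4 < q div 4" "q mod 4 = Suc p mod 4"
  shows "adj p q"
proof -
  have "p div 4 \<noteq> 0" using assms(1) by (simp add: div_eq_0_iff)
  then show ?thesis using assms by (auto simp: adj_def mod_Suc_eq)
qed

lemma Suc_mod_4_inject: "s < 4 \<Longrightarrow> t < 4 \<Longrightarrow> Suc s mod 4 = Suc t mod 4 \<Longrightarrow> s = t"
  by (auto simp: mod_Suc split: if_splits)

lemma adj_block_iff:
  assumes "0 < n" "s < 4"
  shows "adj (4 * n + s) w \<longleftrightarrow>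
    (w div 4 = 0 \<and> w mod 4 = s \<or> n < w div 4 \<and> w mod 4 = Suc s mod 4 \<or>
     0 < w div 4 \<and> w div 4 < n \<and> s = Suc (w mod 4) mod 4)"
proof -
  have eqs: "(4 * n + s) div 4 = n" "(4 * n + s) mod 4 = s" using assms by auto
  show ?thesis
    unfolding adj_def eqs using assms(1) by (cases "w div 4 = 0"; cases n "w div 4" rule: linorder_cases) auto
qed

text \<open>
  A common neighbour in block \<open>0\<close>, in a later block or in an earlier block would have a type
  that determines the type of its neighbour in block \<open>n\<close>.
\<close>
lemma no_common_neighbour_same_block:
  assumes "0 < n" "s < 4" "t < 4" "s \<noteq> t" "adj (4 * n + s) w"
  shows "\<not> adj w (4 * n + t)"
proof
  assume "adj w (4 * n + t)"
  then have "adj (4 * n + t) w" by (simp add: adj_sym)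
  then have "s = t"
    using assms(5) Suc_mod_4_inject[OF assms(2,3)]
    unfolding adj_block_iff[OF assms(1,2)] adj_block_iff[OF assms(1,3)] by linarith
  then show False using assms(4) by simp
qed

lemma no_common_neighbour_backward:
  assumes "0 < n" "n < k" "adj (4 * n + 1) w"
  shows "\<not> adj w (4 * k + 0)"
proof
  assume "adj w (4 * k + 0)"
  then have "adj (4 * k + 0) w" by (simp only: adj_sym)
  then show False
    using assms adj_block_iff[of n 1 w] adj_block_iff[of k 0 w] by (auto simp: mod_Suc)
qed

text \<open>
  Every vertex is joined to every other through the hubs of their types.
\<close>
lemma edges_reach: "\<exists>n\<le>3. (p, q) \<in> edges ^^ n"
proof -
  have step: "\<exists>n\<le>Suc N. (p, y) \<in> edges ^^ n"
    if "\<exists>n\<le>N. (p, x) \<in> edges ^^ n" "x = y \<or> adj x y" for N x y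
    using that by (auto simp: edges_def intro: relpow_Suc_I le_SucI)
  have "\<exists>n\<le>0. (p, p) \<in> edges ^^ n" by simp
  from step[OF this adj_hub] have "\<exists>n\<le>1. (p, p mod 4) \<in> edges ^^ n" by simp
  from step[OF this adj_hubs] have "\<exists>n\<le>Suc 1. (p, q mod 4) \<in> edges ^^ n" .
  moreover have "q mod 4 = q \<or> adj (q mod 4) q" using adj_hub[of q] adj_sym by metis
  ultimately have "\<exists>n\<le>Suc (Suc 1). (p, q) \<in> edges ^^ n" by (rule step)
  then show ?thesis by (simp add: numeral_3_eq_3)
qed

lemma connected_edges: "connected_graph UNIV edges"
  unfolding connected_graph_def
proof (intro conjI ballI)
  show "sym edges" using adj_sym by (auto simp: sym_def edges_def)
  show "irrefl edges" using adj_irrefl by (auto simp: irrefl_def edges_def)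
  show "(p, q) \<in> edges\<^sup>*" for p q using edges_reach[of p q] relpow_imp_rtrancl by blast
qed simp

definition graph_metric :: "nat metric" where
  "graph_metric = metric (UNIV, \<lambda>x y. real (path_dist edges x y))"

lemma mspace_graph_metric [simp]: "mspace graph_metric = UNIV"
  unfolding graph_metric_def
  by (rule Metric_space.mspace_metric[OF Metric_space_path_dist[OF connected_edges]])

lemma mdist_graph_metric: "mdist graph_metric = (\<lambda>x y. real (path_dist edges x y))"
  unfolding graph_metric_def
  by (rule Metric_space.mdist_metric[OF Metric_space_path_dist[OF connected_edges]])

lemma mdist_le_3: "mdist graph_metric x y \<le> 3"
  using edges_reach[of x y] path_dist_le[of x y _ edges] by (force simp: mdist_graph_metric)

lemma mdist_values: "mdist graph_metric x y \<in> {0, 1, 2, 3}"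
proof -
  have "path_dist edges x y \<le> 3" using mdist_le_3[of x y] by (simp add: mdist_graph_metric)
  then have "path_dist edges x y \<in> {0, 1, 2, 3}" by auto
  then show ?thesis by (auto simp: mdist_graph_metric)
qed

lemma mdist_ge_1: "x \<noteq> y \<Longrightarrow> 1 \<le> mdist graph_metric x y"
  using mdist_values[of x y] mdist_zero[of x graph_metric y] by auto

lemma mdist_adj: "adj x y \<Longrightarrow> mdist graph_metric x y \<le> 1"
  using path_dist_le[of x y 1 edges] by (simp add: mdist_graph_metric edges_def)

lemma edges_rtrancl: "(x, y) \<in> edges\<^sup>*"
  using connected_edges by (simp add: connected_graph_def)

lemma mdist_ge_2: "x \<noteq> y \<Longrightarrow> \<not> adj x y \<Longrightarrow> 2 \<le> mdist graph_metric x y"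
  using path_dist_ge_2[OF edges_rtrancl, of x y] by (simp add: mdist_graph_metric edges_def)

lemma mdist_ge_3:
  "x \<noteq> y \<Longrightarrow> \<not> adj x y \<Longrightarrow> (\<And>w. adj x w \<Longrightarrow> \<not> adj w y) \<Longrightarrow> 3 \<le> mdist graph_metric x y"
  using path_dist_ge_3[OF edges_rtrancl, of x y] by (simp add: mdist_graph_metric edges_def)

lemma mdist_same_block:
  assumes "0 < n" "s < 4" "t < 4" "s \<noteq> t"
  shows "3 \<le> mdist graph_metric (4 * n + s) (4 * n + t)"
proof (rule mdist_ge_3)
  show "\<not> adj (4 * n + s) (4 * n + t)" using assms by (simp add: adj_block_iff)
qed (use assms no_common_neighbour_same_block in auto)

lemma mdist_backward:
  assumes "0 < n" "n < k"
  shows "3 \<le> mdist graph_metric (4 * n + 1) (4 * k + 0)"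
proof (rule mdist_ge_3)
  show "\<not> adj (4 * n + 1) (4 * k + 0)" using assms adj_block_iff[of n 1 "4 * k + 0"] by simp
  show "4 * n + 1 \<noteq> 4 * k + 0" by presburger
qed (rule no_common_neighbour_backward[OF assms])

lemma mdist_same_type:
  assumes "0 < n" "n < k" "s < 4"
  shows "2 \<le> mdist graph_metric (4 * n + s) (4 * k + s)"
proof (rule mdist_ge_2)
  have "s \<noteq> Suc s mod 4" using assms(3) by (simp add: mod_Suc)
  then show "\<not> adj (4 * n + s) (4 * k + s)" using assms by (simp add: adj_block_iff)
qed (use assms in simp)

section \<open>Asymptotic oscillation along half sums\<close>

lemma pigeonhole_parities:
  assumes "\<And>n::nat. \<exists>p\<ge>n. \<exists>q\<ge>n. Q p q"
  shows "\<exists>i j. \<forall>n::nat. \<exists>p\<ge>n. \<exists>q\<ge>n. Q p q \<and> p mod 2 = i \<and> q mod 2 = j"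
proof (rule ccontr)
  assume "\<not> ?thesis"
  then have "\<forall>i j. \<exists>n. \<forall>p\<ge>n. \<forall>q\<ge>n. Q p q \<longrightarrow> \<not> (p mod 2 = i \<and> q mod 2 = j)" by blast
  then obtain b where b: "\<And>i j p q. b i j \<le> p \<Longrightarrow> b i j \<le> q \<Longrightarrow> Q p q \<Longrightarrow> \<not> (p mod 2 = i \<and> q mod 2 = j)"
    by metis
  define N where "N = b 0 0 + b 0 1 + b 1 0 + b 1 (1::nat)"
  obtain p q where pq: "p \<ge> N" "q \<ge> N" "Q p q" using assms by blast
  have "p mod 2 = 0 \<or> p mod 2 = 1" "q mod 2 = 0 \<or> q mod 2 = 1" by auto
  then have "b (p mod 2) (q mod 2) \<le> N" by (auto simp: N_def)
  then show False using b[of "p mod 2" "q mod 2" p q] pq by simp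
qed

lemma parity_mod_4:
  fixes p q :: nat
  shows "p mod 2 = q mod 2 \<Longrightarrow> (2 * q + 5) mod 4 = Suc (2 * p + 4) mod 4"
    and "p mod 2 \<noteq> q mod 2 \<Longrightarrow> (2 * q + 4) mod 4 = Suc (2 * p + 5) mod 4"
proof -
  have double: "(2 * k + 4) mod 4 = 2 * (k mod 2)" for k :: nat
    using mult_mod_right[of 2 k 2] by simp
  {
    assume "p mod 2 = q mod 2"
    then have "Suc ((2 * q + 4) mod 4) mod 4 = Suc ((2 * p + 4) mod 4) mod 4"
      by (simp only: double)
    then show "(2 * q + 5) mod 4 = Suc (2 * p + 4) mod 4"
      unfolding mod_Suc_eq by (simp add: add.commute)
  }
  assume "p mod 2 \<noteq> q mod 2"
  then have "q mod 2 = Suc p mod 2" by (auto simp: mod_Suc)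
  then show "(2 * q + 4) mod 4 = Suc (2 * p + 5) mod 4"
    using double[of q] double[of "Suc p"] by simp
qed

text \<open>
  The key estimate: a nonexpansive function oscillates asymptotically by at most \<open>1\<close> along the
  half sums over the pairs \<open>{2 * p + 4, 2 * p + 5}\<close>. If the half sums at \<open>P k\<close> and \<open>Q k\<close> differed by more
  than \<open>b > 1\<close> for all \<open>k\<close>, label the pairs as \<open>A, B\<close> in such a way that \<open>A (P k)\<close> is adjacent to
  \<open>B (Q l)\<close> and \<open>A (Q k)\<close> to \<open>B (P l)\<close> whenever \<open>l\<close> is large compared with \<open>k\<close>. By compactness the
  difference of the values at \<open>B (P k)\<close> and \<open>B (Q k)\<close> is almost the same at \<open>l\<close>, and the
  two edges give the contradiction.
\<close>
lemma eventually_small_oscillation: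
  fixes f :: "nat \<Rightarrow> real"
  assumes lip: "\<And>x y. \<bar>f x - f y\<bar> \<le> mdist graph_metric x y" and "1 < b"
  shows "\<exists>n. \<forall>p\<ge>n. \<forall>q\<ge>n.
    \<bar>(f (2 * p + 4) + f (2 * p + 5)) / 2 - (f (2 * q + 4) + f (2 * q + 5)) / 2\<bar> \<le> b"
proof (rule ccontr)
  define S where "S p = f (2 * p + 4) + f (2 * p + 5)" for p
  assume "\<not> ?thesis"
  then have neg: "\<exists>p\<ge>n. \<exists>q\<ge>n. b < \<bar>S p / 2 - S q / 2\<bar>" for n by (fastforce simp: S_def not_le)
  have "\<exists>p\<ge>n. \<exists>q\<ge>n. 2 * b < S p - S q" for n
  proof -
    obtain p q where pq: "p \<ge> n" "q \<ge> n" "b < \<bar>S p / 2 - S q / 2\<bar>" using neg by blast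
    then have "2 * b < S p - S q \<or> 2 * b < S q - S p" by (auto simp: abs_if split: if_splits)
    then show ?thesis using pq by blast
  qed
  then obtain i j :: nat where
    "\<forall>n. \<exists>p\<ge>n. \<exists>q\<ge>n. 2 * b < S p - S q \<and> p mod 2 = i \<and> q mod 2 = j"
    using pigeonhole_parities[of "\<lambda>p q. 2 * b < S p - S q"] by blast
  then obtain P Q where P: "\<And>n. n \<le> P n" "\<And>n. P n mod 2 = i"
    and Q: "\<And>n. n \<le> Q n" "\<And>n. Q n mod 2 = j" and gap: "\<And>n. 2 * b < S (P n) - S (Q n)"
    by metis
  have adj1: "\<bar>f x - f y\<bar> \<le> 1" if "adj x y" for x y
    using lip[of x y] mdist_adj[OF that] by simp
  \<comment> \<open>The pair consists of types 0 and 1 for even indices and of types 2 and 3 for odd ones.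
      If the parities agree, the edges between the pairs run from the lower type to the upper one,
      otherwise from the upper type to the lower one of the other pair.\<close>
  define e where "e = (if i = j then 0 else 1 :: nat)"
  define A B where "A p = 2 * p + 4 + e" and "B p = 2 * p + 5 - e" for p
  have S_eq: "S p = f (A p) + f (B p)" for p by (simp add: S_def A_def B_def e_def add.commute)
  have cross: "adj (A (P k)) (B (Q l))" "adj (A (Q k)) (B (P l))"
    if "P k + Q k + 2 \<le> l" for k l
  proof -
    have le: "P k + 2 \<le> Q l" "Q k + 2 \<le> P l"
      using that P(1)[of l] Q(1)[of l] by auto
    have mods: "P k mod 2 = i" "P l mod 2 = i" "Q k mod 2 = j" "Q l mod 2 = j" using P Q by auto
    have "B (Q l) mod 4 = Suc (A (P k)) mod 4 \<and> B (P l) mod 4 = Suc (A (Q k)) mod 4"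
    proof (cases "i = j")
      case True
      then have "Q l mod 2 = P k mod 2" "P l mod 2 = Q k mod 2" using mods by auto
      then show ?thesis using True parity_mod_4(1)[of "P k" "Q l"] parity_mod_4(1)[of "Q k" "P l"]
        unfolding A_def B_def e_def by simp
    next
      case False
      then have "Q l mod 2 \<noteq> P k mod 2" "P l mod 2 \<noteq> Q k mod 2" using mods by auto
      then show ?thesis using False parity_mod_4(2)[of "P k" "Q l"] parity_mod_4(2)[of "Q k" "P l"]
        unfolding A_def B_def e_def by simp
    qed
    moreover have "A (P k) div 4 < B (Q l) div 4" "A (Q k) div 4 < B (P l) div 4"
      using le by (auto simp: A_def B_def e_def)
    ultimately show "adj (A (P k)) (B (Q l))" "adj (A (Q k)) (B (P l))"
      by (auto intro!: adj_forward simp: A_def)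
  qed
  define g where "g k = f (B (P k)) - f (B (Q k))" for k
  have "\<bar>g k\<bar> \<le> 3" for k
    using lip[of "B (P k)" "B (Q k)"] mdist_le_3[of "B (P k)" "B (Q k)"] by (simp add: g_def)
  then have "bounded (range g)" by (auto simp: bounded_iff)
  then obtain l r where r: "strict_mono r" and "(g \<circ> r) \<longlonglongrightarrow> l"
    using bounded_imp_convergent_subsequence by blast
  then have "Cauchy (g \<circ> r)" using LIMSEQ_imp_Cauchy by blast
  moreover have "0 < 2 * b - 2" using \<open>1 < b\<close> by simp
  ultimately obtain N where N: "\<And>m n. N \<le> m \<Longrightarrow> N \<le> n \<Longrightarrow> dist ((g \<circ> r) m) ((g \<circ> r) n) < 2 * b - 2"
    unfolding Cauchy_def by metis
  define k where "k = r N"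
  define M where "M = max N (P k + Q k + 2)"
  define l where "l = r M"
  have "P k + Q k + 2 \<le> l"
    using strict_mono_imp_increasing[OF r, of M] by (simp add: l_def M_def)
  from cross[OF this] have "\<bar>f (A (P k)) - f (B (Q l))\<bar> \<le> 1" "\<bar>f (A (Q k)) - f (B (P l))\<bar> \<le> 1"
    by (auto intro: adj1)
  moreover have "\<bar>g k - g l\<bar> < 2 * b - 2"
    using N[of N M] by (simp add: k_def l_def M_def dist_real_def)
  ultimately show False using gap[of k] unfolding S_eq g_def by linarith
qed

section \<open>The free space of the graph\<close>

text \<open>
  The distinguished point of the graph is arbitrary.
\<close>
locale pointed_graph =
  fixes z :: nat

sublocale pointed_graph \<subseteq> separated_metric graph_metric z 3
  by unfold_locales (auto intro: mdist_ge_1 mdist_le_3)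

context pointed_graph
begin

text \<open>
  The half sum of two evaluations.
\<close>
definition mid :: "nat \<Rightarrow> nat \<Rightarrow> (nat \<Rightarrow> real) \<Rightarrow> real" where
  "mid a b = (1 / 2) *\<^sub>R (ev a + ev b)"

lemma mid_in_F: "mid a b \<in> F"
  unfolding mid_def
  by (intro subspace_scale[OF subspace_free_space] subspace_add[OF subspace_free_space] ev_in_free)

lemma mid_in_D: "mid a b \<in> D"
  using mid_in_F free_space_subset_dual by blast

lemma mid_apply: "g \<in> Lip0 graph_metric z \<Longrightarrow> mid a b g = (g a + g b) / 2"
  by (simp add: mid_def scaleR_fun_def)

lemma mid_diff_D: "mid a b - mid c d \<in> D"
  using mid_in_D subspace_diff[OF subspace_dual_space] by blast

lemma mid_diff_le: "FN (mid a b - mid c d) \<le> (mdist graph_metric a c + mdist graph_metric b d) / 2"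
proof (rule free_norm_least)
  fix g assume g: "short g"
  have "\<bar>g a - g c\<bar> \<le> mdist graph_metric a c" "\<bar>g b - g d\<bar> \<le> mdist graph_metric b d"
    using g by (auto simp: short_def)
  moreover have val: "(mid a b - mid c d) g = (g a + g b) / 2 - (g c + g d) / 2"
    using g by (simp add: mid_apply short_Lip0)
  ultimately show "\<bar>(mid a b - mid c d) g\<bar> \<le> (mdist graph_metric a c + mdist graph_metric b d) / 2"
    unfolding val by (simp add: field_simps)
qed

lemma mid_diff_ge:
  assumes "\<And>x y. \<bar>f x - f y\<bar> \<le> mdist graph_metric x y"
  shows "(f a + f b) / 2 - (f c + f d) / 2 \<le> FN (mid a b - mid c d)"
proof -
  have sh: "short (rebase f)" by (rule short_rebase) (rule assms)
  have "(f a + f b) / 2 - (f c + f d) / 2 = (mid a b - mid c d) (rebase f)"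
    using short_Lip0[OF sh] by (simp add: mid_apply) (simp add: rebase_def field_simps)
  then show ?thesis using free_norm_upper[OF mid_diff_D sh, of a b c d] by simp
qed

lemma bounded_seq_mid: "bounded_seq F FN (\<lambda>k. mid (u k) (v k))"
  unfolding bounded_seq_def
proof (intro conjI allI exI)
  fix k show "FN (mid (u k) (v k)) \<le> 3"
  proof (rule free_norm_least)
    fix g assume "short g"
    moreover from this have "\<bar>g a\<bar> \<le> 3" for a
      using mdist_le_3[of a z] by (fastforce simp: short_def dest: spec[of _ a] spec[of _ z])
    from this[of "u k"] this[of "v k"] have "\<bar>(g (u k) + g (v k)) / 2\<bar> \<le> 3"
      by (simp add: field_simps)
    ultimately show "\<bar>mid (u k) (v k) g\<bar> \<le> 3" by (simp add: mid_apply short_Lip0)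
  qed
qed (rule mid_in_F)

text \<open>
  The sequence that witnesses all the lower bounds: its members at \<open>2 * j\<close> and \<open>2 * j + 1\<close> are the
  half sums over types \<open>0, 1\<close> and over types \<open>2, 3\<close> of block \<open>j + 1\<close>.
\<close>
definition half_sums :: "nat \<Rightarrow> (nat \<Rightarrow> real) \<Rightarrow> real" where
  "half_sums k = mid (2 * k + 4) (2 * k + 5)"

lemma half_sums_even: "half_sums (2 * k) = mid (4 * Suc k + 0) (4 * Suc k + 1)"
  unfolding half_sums_def by (rule arg_cong2[where f=mid]) simp_all

lemma half_sums_odd: "half_sums (2 * k + 1) = mid (4 * Suc k + 2) (4 * Suc k + 3)"
  unfolding half_sums_def by (rule arg_cong2[where f=mid]) simp_all

lemma bounded_seq_half_sums: "bounded_seq F FN (\<lambda>k. half_sums (r k))"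
  unfolding half_sums_def by (rule bounded_seq_mid)

lemma half_sums_diff_le: "FN (half_sums p - half_sums q) \<le> 3"
  using mid_diff_le[of "2 * p + 4" "2 * p + 5" "2 * q + 4" "2 * q + 5"]
    mdist_le_3[of "2 * p + 4" "2 * q + 4"] mdist_le_3[of "2 * p + 5" "2 * q + 5"]
  by (simp add: half_sums_def)

lemma mdist_self [simp]: "mdist graph_metric x x = 0"
  by simp

lemma dist_Lipschitz:
  "\<bar>mdist graph_metric x a - mdist graph_metric y a\<bar> \<le> mdist graph_metric x y"
  using mdist_triangle[of x graph_metric y a] mdist_triangle[of y graph_metric x a]
    mdist_commute[of graph_metric x y] by simp

lemma min_dist_Lipschitz:
  fixes a b :: nat and s :: real
  defines "f \<equiv> \<lambda>x. min (mdist graph_metric x a) (s + mdist graph_metric x b)"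
  shows "\<bar>f x - f y\<bar> \<le> mdist graph_metric x y"
  using dist_Lipschitz[of x a y] dist_Lipschitz[of x b y] unfolding f_def by linarith

lemma half_sums_same_block: "3 \<le> FN (half_sums (2 * j) - half_sums (2 * j + 1))"
proof -
  define n where "n = Suc j"
  define f where "f x = min (mdist graph_metric x (4 * n + 0)) (0 + mdist graph_metric x (4 * n + 1))" for x
  have "3 \<le> f (4 * n + 2)" "3 \<le> f (4 * n + 3)"
    unfolding f_def using mdist_same_block[of n 2 0] mdist_same_block[of n 2 1]
      mdist_same_block[of n 3 0] mdist_same_block[of n 3 1] by (simp_all add: n_def)
  moreover have "f (4 * n + 0) = 0" "f (4 * n + 1) = 0" by (simp_all add: f_def)
  ultimately have "3 \<le> (f (4 * n + 2) + f (4 * n + 3)) / 2 - (f (4 * n + 0) + f (4 * n + 1)) / 2"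
    unfolding add_divide_distrib by linarith
  also have "\<dots> \<le> FN (mid (4 * n + 2) (4 * n + 3) - mid (4 * n + 0) (4 * n + 1))"
    by (rule mid_diff_ge) (unfold f_def, rule min_dist_Lipschitz)
  also have "\<dots> = FN (half_sums (2 * j + 1) - half_sums (2 * j))"
    by (simp only: half_sums_even half_sums_odd n_def)
  also have "\<dots> = FN (half_sums (2 * j) - half_sums (2 * j + 1))"
    by (simp add: free_norm_eq abs_minus_commute)
  finally show ?thesis .
qed

text \<open>
  For \<open>n < k\<close> the vertex of type \<open>0\<close> in block \<open>n\<close> is adjacent to the one of type \<open>1\<close> in block \<open>k\<close>,
  but the other cross pair has distance \<open>3\<close>. Matching both pairs costs \<open>2\<close> either way, and the
  function \<open>f\<close> in the proof is a dual optimum.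
\<close>
lemma half_sums_even_separated:
  assumes "i < j"
  shows "2 \<le> FN (half_sums (2 * i) - half_sums (2 * j))"
proof -
  define n k where "n = Suc i" and "k = Suc j"
  have nk: "0 < n" "n < k" using assms by (auto simp: n_def k_def)
  define f where "f x = min (mdist graph_metric x (4 * k + 0)) (1 + mdist graph_metric x (4 * k + 1))" for x
  have "f (4 * k + 0) \<le> 0" "f (4 * k + 1) \<le> 1" by (simp_all add: f_def)
  moreover have "3 \<le> f (4 * n + 1)"
    using mdist_backward[OF nk] mdist_same_type[OF nk, of 1] by (simp add: f_def)
  moreover have "2 \<le> f (4 * n + 0)"
    using mdist_ge_1[of "4 * n + 0" "4 * k + 1"] mdist_same_type[OF nk, of 0] nk by (simp add: f_def)
  ultimately have "2 \<le> (f (4 * n + 0) + f (4 * n + 1)) / 2 - (f (4 * k + 0) + f (4 * k + 1)) / 2"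
    unfolding add_divide_distrib by linarith
  also have "\<dots> \<le> FN (mid (4 * n + 0) (4 * n + 1) - mid (4 * k + 0) (4 * k + 1))"
    by (rule mid_diff_ge) (unfold f_def, rule min_dist_Lipschitz)
  also have "\<dots> = FN (half_sums (2 * i) - half_sums (2 * j))"
    by (simp only: half_sums_even n_def k_def)
  finally show ?thesis .
qed

lemma half_sums_even_separated_neq:
  assumes "i \<noteq> j"
  shows "2 \<le> FN (half_sums (2 * i) - half_sums (2 * j))"
proof (cases "i < j")
  case False
  then have "2 \<le> FN (half_sums (2 * j) - half_sums (2 * i))" using assms by (intro half_sums_even_separated) simp
  then show ?thesis by (simp add: free_norm_eq abs_minus_commute)
qed (rule half_sums_even_separated)

text \<open>
  A functional of norm at most one restricts to a nonexpansive function on the vertices.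
\<close>
lemma delta_half_sums_le_1:
  assumes r: "\<And>n. n \<le> r n"
  shows "delta F FN (\<lambda>k. half_sums (r k)) \<le> 1"
proof (rule delta_least)
  fix \<Xi> assume \<Xi>: "\<Xi> \<in> dual_ball F FN"
  define f where "f p = \<Xi> (ev p)" for p
  have lip: "\<bar>f p - f q\<bar> \<le> mdist graph_metric p q" for p q
  proof -
    have "\<bar>f p - f q\<bar> \<le> FN (ev p - ev q)"
      unfolding f_def by (rule dual_ball_diff_bound[OF \<Xi> ev_in_free ev_in_free])
    also have "\<dots> \<le> mdist graph_metric p q"
      by (rule free_norm_least) (simp add: short_Lip0, simp add: short_def)
    finally show ?thesis .
  qed
  have "\<Xi> \<in> dual_space F FN" using \<Xi> by (simp add: dual_ball_def)
  then have val: "\<Xi> (half_sums k) = (f (2 * k + 4) + f (2 * k + 5)) / 2" for k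
    unfolding half_sums_def mid_def f_def
    by (simp add: dual_spaceD(1,2) ev_in_free subspace_add[OF subspace_free_space])
  have le3: "\<bar>\<Xi> (half_sums p) - \<Xi> (half_sums q)\<bar> \<le> 3" for p q
    using dual_ball_diff_bound[OF \<Xi>, of "half_sums p" "half_sums q"] half_sums_diff_le[of p q] mid_in_F by (simp add: half_sums_def)
  show "ca abs (\<Xi> \<circ> (\<lambda>k. half_sums (r k))) \<le> 1"
  proof (rule dense_ge)
    fix b :: real assume "1 < b"
    then obtain n where n: "\<And>p q. n \<le> p \<Longrightarrow> n \<le> q \<Longrightarrow> \<bar>\<Xi> (half_sums p) - \<Xi> (half_sums q)\<bar> \<le> b"
      using eventually_small_oscillation[OF lip] unfolding val by blast
    show "ca abs (\<Xi> \<circ> (\<lambda>k. half_sums (r k))) \<le> b"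
    proof (rule ca_le[where B=3 and n=n])
      fix p q assume "n \<le> p" "n \<le> q"
      then have "n \<le> r p" "n \<le> r q" using r order_trans by blast+
      then show "\<bar>(\<Xi> \<circ> (\<lambda>k. half_sums (r k))) p - (\<Xi> \<circ> (\<lambda>k. half_sums (r k))) q\<bar> \<le> b" using n by simp
    qed (use le3 in auto)
  qed
qed

lemma ca_half_sums_ge_3: "3 \<le> ca FN half_sums"
proof (rule ca_ge)
  fix n
  show "\<exists>p\<ge>n. \<exists>q\<ge>n. 3 \<le> FN (half_sums p - half_sums q)"
    using half_sums_same_block[of n] by (intro exI[of _ "2 * n"] exI[of _ "2 * n + 1"] conjI) auto
qed (rule half_sums_diff_le)

lemma not_Schur_property:
  assumes "c < 3"
  shows "\<not> Schur_property c F FN"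
proof
  assume "Schur_property c F FN"
  then have "ca FN half_sums \<le> c * delta F FN half_sums"
    using bounded_seq_half_sums[of id] by (simp add: Schur_property_def)
  moreover have "0 \<le> delta F FN half_sums" "delta F FN half_sums \<le> 1"
    using delta_nonneg[OF bounded_seq_half_sums[of id]] delta_half_sums_le_1[of id] by simp_all
  then have "c * delta F FN half_sums \<le> max 0 c * 1" by (intro mult_mono) auto
  ultimately show False using ca_half_sums_ge_3 assms by simp
qed

lemma ca_tilde_half_sums_even_ge_2: "2 \<le> ca_tilde FN (\<lambda>k. half_sums (2 * k))"
  unfolding ca_tilde_def
proof (rule cINF_greatest)
  show "{r::nat \<Rightarrow> nat. strict_mono r} \<noteq> {}" using strict_mono_id by blast
  fix r :: "nat \<Rightarrow> nat" assume "r \<in> {r. strict_mono r}"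
  then have r: "strict_mono r" by simp
  show "2 \<le> ca FN ((\<lambda>k. half_sums (2 * k)) \<circ> r)"
  proof (rule ca_ge[where B=3])
    fix n
    have "2 \<le> FN (half_sums (2 * r n) - half_sums (2 * r (Suc n)))"
      using r by (intro half_sums_even_separated) (simp add: strict_mono_less)
    then show "\<exists>p\<ge>n. \<exists>q\<ge>n. 2 \<le> FN (((\<lambda>k. half_sums (2 * k)) \<circ> r) p - ((\<lambda>k. half_sums (2 * k)) \<circ> r) q)"
      by (intro exI[of _ n] exI[of _ "Suc n"] conjI) auto
  qed (simp add: half_sums_diff_le)
qed

lemma ca_tilde_fails:
  assumes "c < 2"
  shows "\<exists>x. bounded_seq F FN x \<and> \<not> ca_tilde FN x \<le> c * delta F FN x"
proof (intro exI conjI)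
  let ?x = "\<lambda>k. half_sums (2 * k)"
  show bd: "bounded_seq F FN ?x" by (rule bounded_seq_half_sums)
  have "0 \<le> delta F FN ?x" "delta F FN ?x \<le> 1"
    using delta_nonneg[OF bd] delta_half_sums_le_1[of "\<lambda>k. 2 * k"] by simp_all
  then have "c * delta F FN ?x \<le> max 0 c * 1" by (intro mult_mono) auto
  then show "\<not> ca_tilde FN ?x \<le> c * delta F FN ?x" using ca_tilde_half_sums_even_ge_2 assms by simp
qed

lemma not_one_strong_Schur: "\<not> one_strong_Schur F FN"
proof
  assume strong: "one_strong_Schur F FN"
  \<comment> \<open>Subtracting the half sum over two hubs normalizes the even members.\<close>
  define y where "y k = half_sums (2 * k) - mid 0 1" for k
  have y_diff: "y i - y j = half_sums (2 * i) - half_sums (2 * j)" for i j by (simp add: y_def)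
  have yF: "y k \<in> F" for k
    unfolding y_def half_sums_def using mid_in_F subspace_diff[OF subspace_free_space] by blast
  have sep: "2 \<le> FN (y i - y j)" if "i \<noteq> j" for i j
    unfolding y_diff using that by (rule half_sums_even_separated_neq)
  have yD: "y k \<in> D" for k using yF free_space_subset_dual by blast
  have le1: "FN (y k) \<le> 1" for k
  proof -
    have "adj (4 * k + 4) 0" "adj (4 * k + 5) 1" by (simp_all add: adj_def)
    then show ?thesis
      using mid_diff_le[of "4 * k + 4" "4 * k + 5" 0 1] mdist_adj[of "4 * k + 4" 0] mdist_adj[of "4 * k + 5" 1]
      by (simp add: y_def half_sums_def)
  qed
  have norm1: "FN (y k) = 1" for k
    using free_norm_diff[OF yD yD, of k "Suc k"] sep[of k "Suc k"] le1[of k] le1[of "Suc k"] by simp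
  have "\<exists>r::nat \<Rightarrow> nat. strict_mono r \<and> equiv_l1_basis (2 / 2 + 1 / 4) FN (y \<circ> r)"
    using strong[unfolded one_strong_Schur_def, rule_format, of 2 "1 / 4" y] sep norm1 yF by auto
  then obtain r :: "nat \<Rightarrow> nat" where r: "strict_mono r"
    and eq: "equiv_l1_basis (2 / 2 + 1 / 4) FN (y \<circ> r)" by blast
  \<comment> \<open>Alternating signs let the edges from type 0 to type 1 of later blocks cancel most of the mass:
      four terms have norm at most 3, while equivalence with constant 5/4 would require 16/5.\<close>
  let ?a = "\<lambda>j::nat. (-1::real) ^ j"
  let ?v = "\<Sum>j<4. ?a j *\<^sub>R (y \<circ> r) j"
  have "(1 / (2 / 2 + 1 / 4)) * (\<Sum>j<4. \<bar>?a j\<bar>) \<le> FN ?v"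
    using eq unfolding equiv_l1_basis_def by blast
  moreover have "(\<Sum>j<4. \<bar>?a j\<bar>) = 4" by simp
  ultimately have "16 / 5 \<le> FN ?v" by simp
  also have "FN ?v \<le> 3"
  proof (rule free_norm_least)
    fix g assume g: "short g"
    define u where "u j = g (4 * r j + 4)" for j
    define w where "w j = g (4 * r j + 5)" for j
    have v_eq: "?v = y (r 0) - y (r 1) + y (r 2) - y (r 3)"
      by (simp add: numeral_eq_Suc)
    have val: "y k g = (g (4 * k + 4) + g (4 * k + 5)) / 2 - (g 0 + g 1) / 2" for k
      using short_Lip0[OF g] by (simp add: y_def half_sums_def mid_apply)
    have v_val: "?v g = (u 0 + w 0 - u 1 - w 1 + u 2 + w 2 - u 3 - w 3) / 2"
      unfolding v_eq by (simp add: u_def w_def val field_simps)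
    have close: "\<bar>u i - w j\<bar> \<le> 1" if "i < j" for i j
    proof -
      have "r i < r j" using r that by (simp add: strict_mono_less)
      then have "adj (4 * r i + 4) (4 * r j + 5)"
        by (intro adj_forward) auto
      then show ?thesis using g mdist_adj unfolding short_def u_def w_def by (meson order_trans)
    qed
    from close[of 0 1] close[of 1 2] close[of 2 3]
    have "\<bar>u 0 - w 1\<bar> \<le> 1" "\<bar>u 1 - w 2\<bar> \<le> 1" "\<bar>u 2 - w 3\<bar> \<le> 1" by simp_all
    moreover have "\<bar>w 0 - u 3\<bar> \<le> 3"
      using g mdist_le_3 unfolding short_def u_def w_def by (meson order_trans)
    ultimately show "\<bar>?v g\<bar> \<le> 3" unfolding v_val by (simp add: field_simps)
  qed
  finally show False by simp
qed

end

theorem mainTheorem14: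
  shows "\<exists>m :: nat metric. mspace m \<noteq> {} \<and>
    (countable (mspace m) \<and>
      (\<exists>E. connected_graph (mspace m) E \<and>
        (\<forall>x\<in>mspace m. \<forall>y\<in>mspace m. mdist m x y = real (path_dist E x y)))) \<and>
    (\<forall>x\<in>mspace m. \<forall>y\<in>mspace m. mdist m x y \<in> {0, 1, 2, 3}) \<and>
    (\<forall>z\<in>mspace m.
      (Schur_property 3 (free_space m z) (free_norm m z) \<and>
        (\<forall>c<3. \<not> Schur_property c (free_space m z) (free_norm m z))) \<and>
      ((\<forall>c<2. \<not> (\<forall>x. bounded_seq (free_space m z) (free_norm m z) x \<longrightarrow>
            ca_tilde (free_norm m z) x \<le> c * delta (free_space m z) (free_norm m z) x)) \<and>
        \<not> one_strong_Schur (free_space m z) (free_norm m z)))"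
proof (rule exI[of _ graph_metric], intro conjI ballI allI impI)
  show "mspace graph_metric \<noteq> {}" "countable (mspace graph_metric)" by simp_all
  show "\<exists>E. connected_graph (mspace graph_metric) E \<and>
      (\<forall>x\<in>mspace graph_metric. \<forall>y\<in>mspace graph_metric.
        mdist graph_metric x y = real (path_dist E x y))"
    using connected_edges by (auto simp: mdist_graph_metric)
  show "mdist graph_metric x y \<in> {0, 1, 2, 3}" for x y by (rule mdist_values)
  fix z :: nat
  interpret pointed_graph z .
  show "Schur_property 3 F FN" by (rule Schur_property_diameter)
  show "\<not> Schur_property c F FN" if "c < 3" for c using that by (rule not_Schur_property)
  show "\<not> (\<forall>x. bounded_seq F FN x \<longrightarrow> ca_tilde FN x \<le> c * delta F FN x)" if "c < 2" for c
    using ca_tilde_fails[OF that] by blast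
  show "\<not> one_strong_Schur F FN" by (rule not_one_strong_Schur)
qed

end
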